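(* Let $\dot W^\alpha$ be a symmetric $\alpha$-stable Lévy white noise on $\mathbb{R}^d$, and consider the stochastic Poisson equation in $\mathbb{R}^d$ $$-\Delta u=\dot W^\alpha,\qquad\Delta=\sum_{i=1}^d\frac{\partial^2}{\partial x_i^2},$$ with the fundamental solution $\rho_{\mathcal{P}}^d$ of $-\Delta$ given in the context. (a) For $d\ge1$ and $\alpha\in(0,2)$, there is no mild solution, hence no random field solution, to $-\Delta u=\dot W^\alpha$. (b) There is a generalized solution to $-\Delta u=\dot W^\alpha$ if and only if $d>4$ and $\alpha\in\left(\frac{d}{d-2},2\right)$.
   Context: The fundamental solution of $\mathcal{P}=-\Delta$ on $\mathbb{R}^d$ is fixed to be $$\rho_{\mathcal{P}}^1(x)=-\tfrac12|x|\ (x\in\mathbb{R}),\qquad\rho_{\mathcal{P}}^2(x)=\frac1{2\pi}\ln\frac1{|x|}\ (x\in\mathbb{R}^2\setminus\{0\}),\qquad\rho_{\mathcal{P}}^d(x)=\frac1{C_d}\frac1{|x|^{d-2}}\ (x\in\mathbb{R}^d\setminus\{0\},\ d\ge3),$$ where $C_d=\frac{2\pi^{d/2}(d-2)}{\Gamma(d/2)}$. $\mathcal{D}(\mathbb{R}^d)$ is the space of (real-valued) $C^\infty$ compactly supported functions. For $\varphi\in\mathcal{D}(\mathbb{R}^d)$, $(\varphi*\check\rho_{\mathcal{P}}^d)(x)=\int_{\mathbb{R}^d}\rho_{\mathcal{P}}^d(y-x)\varphi(y)\,\mathrm{d}y$. For $\alpha\in(0,2)$, $L^\alpha(\mathbb{R}^d)$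 is the set of measurable $f$ with $\int_{\mathbb{R}^d}|f|^\alpha<\infty$. Symmetric $\alpha$-stable Lévy white noise on $\mathbb{R}^d$, $\alpha\in(0,2)$: $\dot W^\alpha$ is an independently scattered symmetric $\alpha$-stable random measure on $\mathbb{R}^d$ with $\mathbb{E}(e^{iu\dot W^\alpha(A)})=\exp(-\mathrm{Leb}_d(A)|u|^\alpha)$, $u\in\mathbb{R}$, for Borel $A$ of finite Lebesgue measure. A deterministic measurable function $f$ is integrable with respect to $\dot W^\alpha$ iff $f\in L^\alpha(\mathbb{R}^d)$; the integral is denoted $\langle\dot W^\alpha,f\rangle$, with $\mathbb{E}(e^{i\langle\dot W^\alpha,f\rangle})=\exp(-\int_{\mathbb{R}^d}|f|^\alpha)$. The generalized solution is the linear functional $\langle u_{\text{gen}},\varphi\rangle:=\langle\dot W^\alpha,\varphi*\check\rho_{\mathcal{P}}^d\rangle$, $\varphi\in\mathcal{D}(\mathbb{R}^d)$; it exists iff $\varphi*\check\rho_{\mathcal{P}}^d\in L^\alpha(\mathbb{R}^d)$ for all $\varphi\in\mathcal{D}(\mathbb{R}^d)$. The mild solution is $u_{\text{mild}}(x):=\langle\dot W^\alpha,\rho_{\mathcal{P}}^d(x-\cdot)\rangle$; it exists iff $\rho_{\mathcal{P}}^d(x-\cdot)\in L^\alpha(\mathbb{R}^d)$ for all $x\in\mathbb{R}^d$. A random field solution is a random field representation of the generalized solution (when the latter exists), i.e. a jointly measurable random field $(Y_x)_{x\in\mathbb{R}^d}$ with almost surely locally integrable sample paths such that $\langle u_{\text{gen}},\varphi\rangle=\int_{\mathbb{R}^d}Y_x\varphi(x)\,\mathrm{d}x$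 a.s. for every $\varphi\in\mathcal{D}(\mathbb{R}^d)$. *)

theory Defs
  imports "HOL-Probability.Probability"
begin

section \<open>Test functions\<close>

definition partial_deriv :: "'d::finite \<Rightarrow> (real^'d \<Rightarrow> real) \<Rightarrow> real^'d \<Rightarrow> real" where
  "partial_deriv i f x = frechet_derivative f (at x) (axis i 1)"

primrec Ck :: "nat \<Rightarrow> (real^'d \<Rightarrow> real) \<Rightarrow> bool" where
  "Ck 0 f \<longleftrightarrow> continuous_on UNIV f"
| "Ck (Suc k) f \<longleftrightarrow> (\<forall>x. f differentiable (at x)) \<and> (\<forall>i. Ck k (partial_deriv i f))"

definition test_functions :: "(real^'d \<Rightarrow> real) set" where
  "test_functions = {\<phi>. (\<forall>k. Ck k \<phi>) \<and> compact (closure {x. \<phi> x \<noteq> 0})}"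


section \<open>The fundamental solution of minus the Laplacian\<close>

(* For d >= 2 the value at the origin, where the formula is singular, is 0
   because ln (1 / 0) = 0 and 1 / 0 = 0. It is never relevant: all uses are up to null sets. *)
definition rho_P :: "real^'d \<Rightarrow> real" where
  "rho_P x =
     (let d = CARD('d) in
      if d = 1 then - norm x / 2
      else if d = 2 then 1 / (2 * pi) * ln (1 / norm x)
      else 1 / (2 * pi powr (real d / 2) * (real d - 2) / Gamma (real d / 2))
             * (1 / norm x ^ (d - 2)))"

definition conv_rho_P :: "(real^'d \<Rightarrow> real) \<Rightarrow> real^'d \<Rightarrow> real" where
  "conv_rho_P \<phi> x = (\<integral>y. rho_P (y - x) * \<phi> y \<partial>lborel)"


section \<open>Symmetric stable white noise\<close>

(* The random variable W A is only constrained for Borel sets A of finite Lebesgue measure. *)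
locale stable_white_noise = prob_space M
  for M :: "'w measure" +
  fixes \<alpha> :: real and W :: "(real^'d) set \<Rightarrow> 'w \<Rightarrow> real"
  assumes noise_measurable:
      "\<And>A. A \<in> sets borel \<Longrightarrow> emeasure lborel A < \<infinity> \<Longrightarrow> W A \<in> borel_measurable M"
    and noise_char:
      "\<And>A u. A \<in> sets borel \<Longrightarrow> emeasure lborel A < \<infinity> \<Longrightarrow>
         char (distr M borel (W A)) u
           = complex_of_real (exp (- measure lborel A * \<bar>u\<bar> powr \<alpha>))"
    and noise_indep:
      "\<And>A :: nat \<Rightarrow> (real^'d) set.
         (\<And>i. A i \<in> sets borel) \<Longrightarrow> (\<And>i. emeasure lborel (A i) < \<infinity>) \<Longrightarrow>
         disjoint_family A \<Longrightarrow> indep_vars (\<lambda>_. borel) (\<lambda>i. W (A i)) UNIV"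
    and noise_countably_additive:
      "\<And>A :: nat \<Rightarrow> (real^'d) set.
         (\<And>i. A i \<in> sets borel) \<Longrightarrow> disjoint_family A \<Longrightarrow> emeasure lborel (\<Union>i. A i) < \<infinity> \<Longrightarrow>
         AE \<omega> in M. (\<lambda>i. W (A i) \<omega>) sums W (\<Union>i. A i) \<omega>"


section \<open>Stochastic integral of deterministic functions\<close>

definition converges_in_prob ::
  "'w measure \<Rightarrow> (nat \<Rightarrow> 'w \<Rightarrow> real) \<Rightarrow> ('w \<Rightarrow> real) \<Rightarrow> bool" where
  "converges_in_prob M X Y \<longleftrightarrow>
     (\<forall>\<epsilon>>0. (\<lambda>n. measure M {\<omega> \<in> space M. \<epsilon> < \<bar>X n \<omega> - Y \<omega>\<bar>}) \<longlonglongrightarrow> 0)"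

(* The value 0 is left out of the range, since its level set has infinite measure. *)
definition simple_stoch_integral ::
  "((real^'d) set \<Rightarrow> 'w \<Rightarrow> real) \<Rightarrow> (real^'d \<Rightarrow> real) \<Rightarrow> 'w \<Rightarrow> real" where
  "simple_stoch_integral W f \<omega> = (\<Sum>y \<in> range f - {0}. y * W (f -` {y}) \<omega>)"

(* f is integrable with respect to W with integral X (a random variable determined up to
   null sets), in the sense of Urbanik-Woyczynski and Rajput-Rosinski: f is an a.e. limit of
   simple functions whose integrals over every Borel set converge in probability. For
   symmetric alpha-stable noise such an X exists iff |f|^alpha is Lebesgue integrable. *)
definition has_stoch_integral ::
  "'w measure \<Rightarrow> ((real^'d) set \<Rightarrow> 'w \<Rightarrow> real) \<Rightarrow> (real^'d \<Rightarrow> real) \<Rightarrow> ('w \<Rightarrow> real) \<Rightarrow> bool" where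
  "has_stoch_integral M W f X \<longleftrightarrow>
     f \<in> borel_measurable borel \<and> X \<in> borel_measurable M \<and>
     (\<exists>F :: nat \<Rightarrow> real^'d \<Rightarrow> real.
        (\<forall>n. simple_function lborel (F n) \<and> emeasure lborel {x. F n x \<noteq> 0} < \<infinity>) \<and>
        (AE x in lborel. (\<lambda>n. F n x) \<longlonglongrightarrow> f x) \<and>
        (\<forall>A \<in> sets borel. \<exists>Y \<in> borel_measurable M.
           converges_in_prob M (\<lambda>n. simple_stoch_integral W (\<lambda>x. indicator A x * F n x)) Y) \<and>
        converges_in_prob M (\<lambda>n. simple_stoch_integral W (F n)) X)"


section \<open>Notions of solution of the Poisson equation\<close>

definition generalized_solution ::
  "'w measure \<Rightarrow> ((real^'d) set \<Rightarrow> 'w \<Rightarrow> real) \<Rightarrow> ((real^'d \<Rightarrow> real) \<Rightarrow> 'w \<Rightarrow> real) \<Rightarrow> bool" where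
  "generalized_solution M W u \<longleftrightarrow>
     (\<forall>\<phi> \<in> test_functions. has_stoch_integral M W (conv_rho_P \<phi>) (u \<phi>))"

definition mild_solution ::
  "'w measure \<Rightarrow> ((real^'d) set \<Rightarrow> 'w \<Rightarrow> real) \<Rightarrow> (real^'d \<Rightarrow> 'w \<Rightarrow> real) \<Rightarrow> bool" where
  "mild_solution M W u \<longleftrightarrow> (\<forall>x. has_stoch_integral M W (\<lambda>y. rho_P (x - y)) (u x))"

definition random_field_solution ::
  "'w measure \<Rightarrow> ((real^'d) set \<Rightarrow> 'w \<Rightarrow> real) \<Rightarrow> (real^'d \<Rightarrow> 'w \<Rightarrow> real) \<Rightarrow> bool" where
  "random_field_solution M W Y \<longleftrightarrow>
     (\<lambda>(x, \<omega>). Y x \<omega>) \<in> borel_measurable (borel \<Otimes>\<^sub>M M) \<and>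
     (AE \<omega> in M. \<forall>K. compact K \<longrightarrow> set_integrable lborel K (\<lambda>x. Y x \<omega>)) \<and>
     (\<exists>u. generalized_solution M W u \<and>
        (\<forall>\<phi> \<in> test_functions. AE \<omega> in M. u \<phi> \<omega> = (\<integral>x. Y x \<omega> * \<phi> x \<partial>lborel)))"

end

theory Submission
  imports Defs
begin

text \<open>
  A simple function \<open>F\<close> has an integral with characteristic function
  \<open>exp (- \<bar>u\<bar>\<^sup>\<alpha> \<integral>\<bar>F\<bar>\<^sup>\<alpha>)\<close>. Passing to the limit and using Fatou's lemma, the existence of the
  stochastic integral of \<open>f\<close> forces \<open>\<integral>\<bar>f\<bar>\<^sup>\<alpha> < \<infinity>\<close>; conversely \<open>L\<^sup>\<alpha>\<close> approximation by simple
  functions gives integrals that are Cauchy in probability. So mild and generalized solutions are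
  governed by the integrability of \<open>\<bar>x\<bar>\<^sup>-\<^sup>p\<close> with \<open>p = max (d - 2) 0 \<cdot> \<alpha>\<close>, which fails on the whole
  space for every \<open>p\<close> (mild solutions) and holds near infinity iff \<open>p > d\<close> (generalized solutions).

  For random field solutions \<open>Y\<close> only tightness of local averages is needed. For a bump \<open>\<phi>\<close> of
  radius \<open>r\<close> around \<open>x\<close>, the average \<open>Z\<^sub>r(x) = \<integral>Y\<phi>\<close> satisfies \<open>\<integral>\<bar>Z\<^sub>r(x)\<bar> dx \<le> \<integral>\<bar>Y\<bar>\<close> over the unit ball
  and the ball of radius 2, so the mean of \<open>1 - cos (t Z\<^sub>r(x))\<close> tends to 0 as \<open>t \<rightarrow> 0\<close>, uniformly
  in \<open>r\<close>. But \<open>Z\<^sub>r(x)\<close> is \<open>\<alpha>\<close>-stable with a scale that tends to infinity as \<open>r \<rightarrow> 0\<close>, because the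
  fundamental solution is not \<open>\<alpha>\<close>-integrable at its singularity when \<open>p \<ge> d\<close>; hence for each fixed
  \<open>t\<close> that mean is close to 1 for small \<open>r\<close>.
\<close>

section \<open>Limits in probability: characteristic functions and completeness\<close>

section \<open>Convergence in probability\<close>

lemma norm_iexp_diff_le: "cmod (iexp a - iexp b) \<le> \<bar>a - b\<bar>"
proof -
  have "iexp a - iexp b = iexp b * (iexp (a - b) - 1)"
    by (simp add: algebra_simps flip: exp_add)
  then have "cmod (iexp a - iexp b) = cmod (iexp (a - b) - 1)"
    by (simp add: norm_mult)
  also have "\<dots> \<le> \<bar>a - b\<bar>"
    using iexp_approx1[of "a - b" 0] by simp
  finally show ?thesis .
qed

context prob_space
begin

lemma char_distr:
  assumes [measurable]: "X \<in> borel_measurable M"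
  shows "char (distr M borel X) t = (CLINT \<omega>|M. iexp (t * X \<omega>))"
  unfolding char_def by (subst integral_distr) auto

text \<open>On the event where \<open>X n\<close> and \<open>Y\<close> differ by more than
  \<open>\<epsilon>\<close> the exponentials differ by at most 2, and this event has small
  probability; elsewhere the Lipschitz bound gives at most
  \<open>\<bar>t\<bar> * \<epsilon>\<close>.\<close>

lemma converges_in_prob_char:
  assumes conv: "converges_in_prob M X Y"
    and [measurable]: "\<And>n. X n \<in> borel_measurable M" "Y \<in> borel_measurable M"
  shows "(\<lambda>n. char (distr M borel (X n)) t) \<longlonglongrightarrow> char (distr M borel Y) t"
proof (rule LIMSEQ_I)
  fix \<delta> :: real assume "0 < \<delta>"
  \<comment> \<open>The 1 in the denominator covers t = 0. The good event then costs at most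
    \<delta>/2, and a bad event of probability below \<delta>/4 costs less than \<delta>/2.\<close>
  define \<epsilon> where "\<epsilon> = \<delta> / (2 * (\<bar>t\<bar> + 1))"
  have "0 < \<epsilon>" using \<open>0 < \<delta>\<close> by (auto simp: \<epsilon>_def intro!: divide_pos_pos add_nonneg_pos)
  have te: "\<bar>t\<bar> * \<epsilon> \<le> \<delta> / 2"
  proof -
    have "\<bar>t\<bar> * \<epsilon> \<le> (\<bar>t\<bar> + 1) * \<epsilon>" using \<open>0 < \<epsilon>\<close> by (intro mult_right_mono) auto
    also have "\<dots> = \<delta> / 2"
    proof -
      have "0 < \<bar>t\<bar> + 1" by (rule add_nonneg_pos) auto
      then show ?thesis unfolding \<epsilon>_def by (metis less_irrefl mult.commute nonzero_mult_divide_mult_cancel_left times_divide_eq_right)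
    qed
    finally show ?thesis .
  qed
  let ?B = "\<lambda>n. {\<omega> \<in> space M. \<epsilon> < \<bar>X n \<omega> - Y \<omega>\<bar>}"
  have "(\<lambda>n. prob (?B n)) \<longlonglongrightarrow> 0"
    using conv \<open>0 < \<epsilon>\<close> unfolding converges_in_prob_def by blast
  then obtain N where N: "\<And>n. n \<ge> N \<Longrightarrow> prob (?B n) < \<delta> / 4"
    using order_tendstoD(2)[of _ 0 sequentially "\<delta> / 4"] \<open>0 < \<delta>\<close>
    unfolding eventually_sequentially by fastforce
  have "cmod (char (distr M borel (X n)) t - char (distr M borel Y) t) < \<delta>" if "n \<ge> N" for n
  proof -
    have int: "integrable M (\<lambda>\<omega>. iexp (t * X n \<omega>))" "integrable M (\<lambda>\<omega>. iexp (t * Y \<omega>))"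
      by (rule integrable_const_bound[of _ 1]; simp)+
    have "char (distr M borel (X n)) t - char (distr M borel Y) t
        = (CLINT \<omega>|M. iexp (t * X n \<omega>) - iexp (t * Y \<omega>))"
      using int by (simp add: char_distr)
    also have "cmod \<dots> \<le> (LINT \<omega>|M. cmod (iexp (t * X n \<omega>) - iexp (t * Y \<omega>)))"
      by (rule integral_norm_bound)
    also have "\<dots> \<le> (LINT \<omega>|M. \<delta> / 2 + 2 * indicator (?B n) \<omega>)"
    proof (rule integral_mono)
      show "integrable M (\<lambda>\<omega>. cmod (iexp (t * X n \<omega>) - iexp (t * Y \<omega>)))"
        using int by auto
      show "integrable M (\<lambda>\<omega>. \<delta> / 2 + 2 * indicator (?B n) \<omega> :: real)"
        by (auto simp: less_top[symmetric])
      fix \<omega> assume "\<omega> \<in> space M"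
      show "cmod (iexp (t * X n \<omega>) - iexp (t * Y \<omega>)) \<le> \<delta> / 2 + 2 * indicator (?B n) \<omega>"
      proof (cases "\<omega> \<in> ?B n")
        case True
        have "cmod (iexp (t * X n \<omega>) - iexp (t * Y \<omega>)) \<le> 1 + 1"
          by (rule order_trans[OF norm_triangle_ineq4]) simp
        then show ?thesis using True \<open>0 < \<delta>\<close> by simp
      next
        case False
        then have "\<bar>X n \<omega> - Y \<omega>\<bar> \<le> \<epsilon>" using \<open>\<omega> \<in> space M\<close> by auto
        have "cmod (iexp (t * X n \<omega>) - iexp (t * Y \<omega>)) \<le> \<bar>t * X n \<omega> - t * Y \<omega>\<bar>"
          by (rule norm_iexp_diff_le)
        also have "\<dots> = \<bar>t\<bar> * \<bar>X n \<omega> - Y \<omega>\<bar>"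
          by (simp add: abs_mult flip: right_diff_distrib)
        also have "\<dots> \<le> \<bar>t\<bar> * \<epsilon>"
          using \<open>\<bar>X n \<omega> - Y \<omega>\<bar> \<le> \<epsilon>\<close> by (intro mult_left_mono) auto
        finally show ?thesis using te False by simp
      qed
    qed
    also have "\<dots> = \<delta> / 2 + 2 * prob (?B n)"
      by (subst Bochner_Integration.integral_add) (auto simp: less_top[symmetric] prob_space)
    also have "\<dots> < \<delta>" using N[OF that] by simp
    finally show ?thesis .
  qed
  then show "\<exists>N. \<forall>n\<ge>N. cmod (char (distr M borel (X n)) t - char (distr M borel Y) t) < \<delta>"
    by blast
qed

text \<open>Tightness of a single random variable: the events decrease to the empty set.\<close>

lemma prob_abs_gt_tendsto_0:
  assumes [measurable]: "X \<in> borel_measurable M"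
  shows "(\<lambda>n. prob {\<omega> \<in> space M. real n < \<bar>X \<omega>\<bar>}) \<longlonglongrightarrow> 0"
proof -
  have "(\<lambda>n. prob {\<omega> \<in> space M. real n < \<bar>X \<omega>\<bar>})
      \<longlonglongrightarrow> prob (\<Inter>n. {\<omega> \<in> space M. real n < \<bar>X \<omega>\<bar>})"
    by (rule finite_Lim_measure_decseq) (auto simp: decseq_def)
  also have "(\<Inter>n. {\<omega> \<in> space M. real n < \<bar>X \<omega>\<bar>}) = {}"
  proof -
    have "\<exists>n. \<not> real n < \<bar>X \<omega>\<bar>" for \<omega>
      by (meson less_asym reals_Archimedean2)
    then show ?thesis by blast
  qed
  finally show ?thesis by simp
qed

text \<open>A subsequence whose consecutive gaps exceed \<open>(1/2)^k\<close> only with summable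
  probabilities converges almost surely by Borel-Cantelli; Fatou's lemma then compares the whole
  sequence with that limit.\<close>

lemma Cauchy_in_prob_imp_converges:
  assumes [measurable]: "\<And>n. X n \<in> borel_measurable M"
    and cauchy: "\<And>\<epsilon> \<eta>. 0 < \<epsilon> \<Longrightarrow> 0 < \<eta> \<Longrightarrow>
      \<exists>N. \<forall>m\<ge>N. \<forall>n\<ge>N. prob {\<omega> \<in> space M. \<epsilon> < \<bar>X m \<omega> - X n \<omega>\<bar>} < \<eta>"
  shows "\<exists>Y\<in>borel_measurable M. converges_in_prob M X Y"
proof -
  have "\<exists>N. \<forall>k. (\<forall>m\<ge>N k. \<forall>n\<ge>N k. prob {\<omega> \<in> space M. (1/2)^k < \<bar>X m \<omega> - X n \<omega>\<bar>} < (1/2)^k)"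
    by (intro choice allI cauchy) auto
  then obtain N where N: "\<And>k m n. m \<ge> N k \<Longrightarrow> n \<ge> N k \<Longrightarrow>
      prob {\<omega> \<in> space M. (1/2)^k < \<bar>X m \<omega> - X n \<omega>\<bar>} < (1/2)^k"
    by blast
  \<comment> \<open>Adding up the thresholds puts both \<open>r k\<close> and
    \<open>r (Suc k)\<close> beyond \<open>N k\<close>; the summand k makes \<open>r\<close> tend to
    infinity.\<close>
  define r where "r k = (\<Sum>i\<le>k. N i) + k" for k
  have r_ge: "r k \<ge> N k" "r (Suc k) \<ge> N k" "r k \<ge> k" for k
    by (auto simp: r_def intro: order_trans[OF member_le_sum[of k "{..k}" N]])
  let ?B = "\<lambda>k. {\<omega> \<in> space M. (1/2)^k < \<bar>X (r (Suc k)) \<omega> - X (r k) \<omega>\<bar>}"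
  have "AE \<omega> in M. eventually (\<lambda>k. \<omega> \<in> space M - ?B k) sequentially"
  proof (rule borel_cantelli_AE1)
    show "summable (\<lambda>k. prob (?B k))"
    proof (rule summable_comparison_test')
      show "summable (\<lambda>k. (1/2)^k :: real)" by (rule summable_geometric) simp
      show "norm (prob (?B k)) \<le> (1/2)^k" for k
        using N[of k "r (Suc k)" "r k"] r_ge[of k] by simp
    qed
  qed (auto simp: less_top[symmetric])
  then have conv: "AE \<omega> in M. convergent (\<lambda>k. X (r k) \<omega>)"
  proof eventually_elim
    case (elim \<omega>)
    have "summable (\<lambda>k. X (r (Suc k)) \<omega> - X (r k) \<omega>)"
    proof (rule summable_comparison_test_ev)
      show "summable (\<lambda>k. (1/2)^k :: real)" by (rule summable_geometric) simp
      show "\<forall>\<^sub>F k in sequentially. norm (X (r (Suc k)) \<omega> - X (r k) \<omega>) \<le> (1/2)^k"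
        using elim by eventually_elim auto
    qed
    then have "convergent (\<lambda>n. X (r n) \<omega> - X (r 0) \<omega>)"
      unfolding summable_iff_convergent using sum_lessThan_telescope[of "\<lambda>k. X (r k) \<omega>"] by simp
    then have "convergent (\<lambda>n. (X (r n) \<omega> - X (r 0) \<omega>) + X (r 0) \<omega>)"
      by (intro convergent_add convergent_const)
    then show ?case by simp
  qed
  \<comment> \<open>On the null set without a limit \<open>lim\<close> takes an unspecified value,
    which convergence in probability does not see.\<close>
  define Y where "Y \<omega> = lim (\<lambda>k. X (r k) \<omega>)" for \<omega>
  have [measurable]: "Y \<in> borel_measurable M"
    unfolding Y_def by measurable
  have "converges_in_prob M X Y"
    unfolding converges_in_prob_def
  proof (intro allI impI LIMSEQ_I)
    fix \<epsilon> \<eta> :: real assume "0 < \<epsilon>" "0 < \<eta>"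
    obtain K where K: "\<And>m n. m \<ge> K \<Longrightarrow> n \<ge> K \<Longrightarrow> prob {\<omega> \<in> space M. \<epsilon> / 2 < \<bar>X m \<omega> - X n \<omega>\<bar>} < \<eta> / 2"
      using cauchy[of "\<epsilon>/2" "\<eta>/2"] \<open>0 < \<epsilon>\<close> \<open>0 < \<eta>\<close> by auto
    have "prob {\<omega> \<in> space M. \<epsilon> < \<bar>X n \<omega> - Y \<omega>\<bar>} \<le> \<eta> / 2" if "n \<ge> K" for n
    proof -
      let ?I = "\<lambda>k \<omega>. indicator {\<omega> \<in> space M. \<epsilon> / 2 < \<bar>X n \<omega> - X (r k) \<omega>\<bar>} \<omega> :: ennreal"
      have "emeasure M {\<omega> \<in> space M. \<epsilon> < \<bar>X n \<omega> - Y \<omega>\<bar>}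
          = (\<integral>\<^sup>+\<omega>. indicator {\<omega> \<in> space M. \<epsilon> < \<bar>X n \<omega> - Y \<omega>\<bar>} \<omega> \<partial>M)"
        by simp
      also have "\<dots> \<le> (\<integral>\<^sup>+\<omega>. liminf (\<lambda>k. ?I k \<omega>) \<partial>M)"
      proof (rule nn_integral_mono_AE)
        show "AE \<omega> in M. indicator {\<omega> \<in> space M. \<epsilon> < \<bar>X n \<omega> - Y \<omega>\<bar>} \<omega> \<le> liminf (\<lambda>k. ?I k \<omega>)"
          using conv
        proof eventually_elim
          case (elim \<omega>)
          show ?case
          proof (cases "\<omega> \<in> {\<omega> \<in> space M. \<epsilon> < \<bar>X n \<omega> - Y \<omega>\<bar>}")
            case True
            \<comment> \<open>If \<open>X n\<close> is more than \<epsilon> away from the limit, it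
              is more than \<epsilon>/2 away from all but finitely many terms of the subsequence, so
              the limit inferior of the indicators is at least 1.\<close>
            have "(\<lambda>k. \<bar>X n \<omega> - X (r k) \<omega>\<bar>) \<longlonglongrightarrow> \<bar>X n \<omega> - Y \<omega>\<bar>"
              using elim unfolding convergent_LIMSEQ_iff Y_def by (intro tendsto_intros)
            then have "\<forall>\<^sub>F k in sequentially. \<epsilon> / 2 < \<bar>X n \<omega> - X (r k) \<omega>\<bar>"
              using True \<open>0 < \<epsilon>\<close> by (intro order_tendstoD) auto
            then have "\<forall>\<^sub>F k in sequentially. 1 \<le> ?I k \<omega>"
              by eventually_elim (use True in auto)
            then have "1 \<le> liminf (\<lambda>k. ?I k \<omega>)"
              by (rule Liminf_bounded)
            then show ?thesis using True by simp
          qed simp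
        qed
      qed
      also have "\<dots> \<le> liminf (\<lambda>k. \<integral>\<^sup>+\<omega>. ?I k \<omega> \<partial>M)"
        by (rule nn_integral_liminf) auto
      also have "\<dots> \<le> ennreal (\<eta> / 2)"
      proof -
        have "\<forall>\<^sub>F k in sequentially. (\<integral>\<^sup>+\<omega>. ?I k \<omega> \<partial>M) \<le> ennreal (\<eta> / 2)"
          using eventually_ge_at_top[of K]
        proof eventually_elim
          case (elim k)
          then show ?case
            using K[of n "r k"] r_ge(3)[of k] that
            by (simp add: emeasure_eq_measure ennreal_leI)
        qed
        then have "limsup (\<lambda>k. \<integral>\<^sup>+\<omega>. ?I k \<omega> \<partial>M) \<le> ennreal (\<eta> / 2)"
          by (rule Limsup_bounded)
        then show ?thesis
          using Liminf_le_Limsup[of sequentially "\<lambda>k. \<integral>\<^sup>+\<omega>. ?I k \<omega> \<partial>M"] by simp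
      qed
      finally show ?thesis
        using \<open>0 < \<eta>\<close> by (simp add: emeasure_eq_measure)
    qed
    then show "\<exists>no. \<forall>n\<ge>no. norm (prob {\<omega> \<in> space M. \<epsilon> < \<bar>X n \<omega> - Y \<omega>\<bar>} - 0) < \<eta>"
      using \<open>0 < \<eta>\<close> by (intro exI[of _ K]) force
  qed
  then show ?thesis by (intro bexI) auto
qed

end

section \<open>Simple functions and their integrals against the noise\<close>

section \<open>Integrability with respect to stable noise\<close>

abbreviation "fin_sets \<equiv> {A \<in> sets (borel :: (real^'d) measure). emeasure lborel A < \<infinity>}"

text \<open>The codomain is left general so that pairs of simple functions are covered as well; a
  pair encodes the common refinement of two families of level sets.\<close>

definition "fin_simple f \<longleftrightarrow> simple_function lborel f \<and> emeasure lborel {x. f x \<noteq> 0} < \<infinity>"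
  for f :: "real^'d \<Rightarrow> 'b::zero"

lemma fin_simple_vimage:
  assumes "fin_simple f" "y \<noteq> 0"
  shows "f -` {y} \<in> fin_sets"
proof -
  have "simple_function lborel f" using assms by (simp add: fin_simple_def)
  then have m: "f -` A \<in> sets borel" for A
    using simple_functionD(2)[of lborel f A] by simp
  have "{x. f x \<noteq> 0} = f -` (- {0})" by auto
  then have "emeasure lborel (f -` {y}) \<le> emeasure lborel {x. f x \<noteq> 0}"
    using m assms(2) by (intro emeasure_mono) auto
  then show ?thesis using m assms unfolding fin_simple_def by auto
qed

lemma fin_simple_finite_range: "fin_simple f \<Longrightarrow> finite (range f)"
  unfolding fin_simple_def by (auto dest: simple_functionD)

lemma fin_simple_compose:
  assumes "fin_simple h" "k 0 = 0"
  shows "fin_simple (\<lambda>x. k (h x))"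
proof -
  have s: "simple_function lborel h" using assms by (simp add: fin_simple_def)
  then have m: "h -` A \<in> sets borel" for A
    using simple_functionD(2)[of lborel h A] by simp
  have "{x. h x \<noteq> 0} = h -` (- {0})" by auto
  then have "emeasure lborel {x. k (h x) \<noteq> 0} \<le> emeasure lborel {x. h x \<noteq> 0}"
    using m assms(2) by (intro emeasure_mono) auto
  then show ?thesis
    using assms s unfolding fin_simple_def by (auto intro: simple_function_compose1)
qed

lemma fin_simple_Pair:
  assumes "fin_simple f" "fin_simple g"
  shows "fin_simple (\<lambda>x. (f x, g x))"
proof -
  have s: "simple_function lborel f" "simple_function lborel g"
    using assms by (auto simp: fin_simple_def)
  then have m: "f -` A \<in> sets borel" "g -` B \<in> sets borel" for A B
    using simple_functionD(2)[of lborel f A] simple_functionD(2)[of lborel g B] by auto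
  have e: "{x. (f x, g x) \<noteq> 0} = f -` (- {0}) \<union> g -` (- {0})"
      "{x. f x \<noteq> 0} = f -` (- {0})" "{x. g x \<noteq> 0} = g -` (- {0})"
    by (auto simp: zero_prod_def)
  have "emeasure lborel {x. (f x, g x) \<noteq> 0} \<le> emeasure lborel {x. f x \<noteq> 0} + emeasure lborel {x. g x \<noteq> 0}"
    unfolding e using m by (intro emeasure_subadditive) auto
  also have "\<dots> < \<infinity>" using assms by (auto simp: fin_simple_def)
  finally show ?thesis
    using s by (auto simp: fin_simple_def intro: simple_function_Pair)
qed

context stable_white_noise
begin

text \<open>Countable additivity for the constant sequence of empty sets gives a convergent series
  with equal terms.\<close>

lemma noise_empty: "AE \<omega> in M. W {} \<omega> = 0"
proof -
  have "AE \<omega> in M. (\<lambda>_::nat. W {} \<omega>) sums W (\<Union>i::nat. {}) \<omega>"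
    by (rule noise_countably_additive) (auto simp: disjoint_family_on_def)
  then show ?thesis
  proof eventually_elim
    case (elim \<omega>)
    then have "(\<lambda>_::nat. W {} \<omega>) \<longlonglongrightarrow> 0"
      by (intro summable_LIMSEQ_zero) (auto simp: sums_iff)
    then show ?case by (simp add: LIMSEQ_const_iff)
  qed
qed

text \<open>Finite additivity comes from countable additivity by padding with empty sets, whose
  noise vanishes almost surely.\<close>

lemma noise_Un:
  assumes "A \<in> fin_sets" "B \<in> fin_sets" "A \<inter> B = {}"
  shows "AE \<omega> in M. W (A \<union> B) \<omega> = W A \<omega> + W B \<omega>"
proof -
  define C where "C i = (if i = 0 then A else if i = 1 then B else {})" for i :: nat
  have U: "(\<Union>i. C i) = A \<union> B"
    by (auto simp: C_def split: if_splits)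
  have "emeasure lborel (A \<union> B) \<le> emeasure lborel A + emeasure lborel B"
    using assms by (intro emeasure_subadditive) auto
  also have "\<dots> < \<infinity>" using assms by auto
  finally have "AE \<omega> in M. (\<lambda>i. W (C i) \<omega>) sums W (\<Union>i. C i) \<omega>"
    using assms U
    by (intro noise_countably_additive) (auto simp: C_def disjoint_family_on_def)
  then show ?thesis
    using noise_empty
  proof eventually_elim
    case (elim \<omega>)
    have "(\<lambda>i. W (C i) \<omega>) sums (\<Sum>i\<in>{0,1}. W (C i) \<omega>)"
      by (rule sums_finite) (use elim in \<open>auto simp: C_def\<close>)
    then have "W (\<Union>i. C i) \<omega> = (\<Sum>i\<in>{0,1}. W (C i) \<omega>)"
      using elim sums_unique2 by blast
    then show ?case unfolding U by (simp add: C_def)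
  qed
qed

lemma noise_finite_UN:
  assumes "finite I" "\<And>i. i \<in> I \<Longrightarrow> A i \<in> fin_sets" "disjoint_family_on A I"
  shows "AE \<omega> in M. W (\<Union>i\<in>I. A i) \<omega> = (\<Sum>i\<in>I. W (A i) \<omega>)"
  using assms
proof (induction I rule: finite_induct)
  case empty
  then show ?case using noise_empty by simp
next
  case (insert i I)
  have "emeasure lborel (\<Union>j\<in>I. A j) \<le> (\<Sum>j\<in>I. emeasure lborel (A j))"
    using insert by (intro emeasure_subadditive_finite) auto
  also have "\<dots> < \<infinity>" using insert by (auto simp: less_top[symmetric])
  finally have U: "(\<Union>j\<in>I. A j) \<in> fin_sets"
    using insert by auto
  have "AE \<omega> in M. W (A i \<union> (\<Union>j\<in>I. A j)) \<omega> = W (A i) \<omega> + W (\<Union>j\<in>I. A j) \<omega>"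
    using insert U by (intro noise_Un) (auto simp: disjoint_family_on_def)
  moreover have "AE \<omega> in M. W (\<Union>i\<in>I. A i) \<omega> = (\<Sum>i\<in>I. W (A i) \<omega>)"
    using insert by (intro insert.IH) (auto simp: disjoint_family_on_def)
  ultimately show ?case
    by eventually_elim (use insert in auto)
qed

text \<open>By independence the characteristic function of the sum is the product of those of the
  summands. Independence is given for sequences indexed by the naturals, hence the enumeration
  \<open>h\<close> of \<open>I\<close> and the padding by empty sets.\<close>

lemma char_noise_sum:
  assumes "finite I" "\<And>i. i \<in> I \<Longrightarrow> A i \<in> fin_sets" "disjoint_family_on A I"
  shows "char (distr M borel (\<lambda>\<omega>. \<Sum>i\<in>I. c i * W (A i) \<omega>)) u
    = complex_of_real (exp (- (\<Sum>i\<in>I. measure lborel (A i) * \<bar>u * c i\<bar> powr \<alpha>)))"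
proof -
  obtain h where h: "bij_betw h {..<card I} I"
    using ex_bij_betw_nat_finite[OF assms(1)] by (auto simp: atLeast0LessThan)
  then have hI: "h k \<in> I" if "k < card I" for k
    using that by (auto simp: bij_betw_def)
  define C where "C k = (if k < card I then A (h k) else {})" for k
  have C: "C k \<in> fin_sets" for k
    using assms(2)[OF hI[of k]] by (auto simp: C_def)
  have disj: "disjoint_family C"
    unfolding disjoint_family_on_def
  proof (intro ballI impI)
    fix k l :: nat assume "k \<noteq> l"
    then show "C k \<inter> C l = {}"
      using h assms(3) hI[of k] hI[of l]
      by (auto simp: C_def disjoint_family_on_def bij_betw_def inj_on_def)
  qed
  have "indep_vars (\<lambda>_. borel) (\<lambda>k. W (C k)) UNIV"
    using C disj by (intro noise_indep) auto
  then have "indep_vars (\<lambda>_. borel) (\<lambda>k. W (C k)) {..<card I}"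
    by (rule indep_vars_subset) auto
  then have indep: "indep_vars (\<lambda>_. borel) (\<lambda>k \<omega>. c (h k) * W (C k) \<omega>) {..<card I}"
    by (rule indep_vars_compose2) auto
  have ch: "char (distr M borel (\<lambda>\<omega>. c (h k) * W (C k) \<omega>)) u
      = complex_of_real (exp (- measure lborel (C k) * \<bar>u * c (h k)\<bar> powr \<alpha>))" for k
  proof -
    have [measurable]: "W (C k) \<in> borel_measurable M"
      using C by (intro noise_measurable) auto
    have "char (distr M borel (\<lambda>\<omega>. c (h k) * W (C k) \<omega>)) u
        = char (distr M borel (W (C k))) (u * c (h k))"
      by (simp add: char_distr mult.assoc)
    also have "\<dots> = complex_of_real (exp (- measure lborel (C k) * \<bar>u * c (h k)\<bar> powr \<alpha>))"
      using C by (intro noise_char) auto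
    finally show ?thesis .
  qed
  have "(\<Sum>i\<in>I. c i * W (A i) \<omega>) = (\<Sum>k<card I. c (h k) * W (C k) \<omega>)" for \<omega>
    by (subst sum.reindex_bij_betw[OF h, symmetric]) (simp add: C_def)
  then have "char (distr M borel (\<lambda>\<omega>. \<Sum>i\<in>I. c i * W (A i) \<omega>)) u
      = (\<Prod>k<card I. complex_of_real (exp (- measure lborel (C k) * \<bar>u * c (h k)\<bar> powr \<alpha>)))"
    using char_distr_sum[OF indep, of u] by (simp add: ch)
  also have "\<dots> = complex_of_real (exp (- (\<Sum>k<card I. measure lborel (C k) * \<bar>u * c (h k)\<bar> powr \<alpha>)))"
    by (simp add: exp_sum sum_negf[symmetric] del: of_real_exp)
  also have "(\<Sum>k<card I. measure lborel (C k) * \<bar>u * c (h k)\<bar> powr \<alpha>)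
      = (\<Sum>i\<in>I. measure lborel (A i) * \<bar>u * c i\<bar> powr \<alpha>)"
    by (subst sum.reindex_bij_betw[OF h, symmetric]) (simp add: C_def)
  finally show ?thesis .
qed

text \<open>Levels of \<open>h\<close> with the same value of \<open>k\<close> merge into one level
  of the composition, so finite additivity lets the integral be computed on the finer partition.
  Applied to a pair, this reduces linearity to finite sums over one partition.\<close>

lemma simple_stoch_integral_compose:
  fixes h :: "real^'d \<Rightarrow> 'b::zero"
  assumes h: "fin_simple h" and k: "k 0 = 0"
  shows "AE \<omega> in M. simple_stoch_integral W (\<lambda>x. k (h x)) \<omega>
    = (\<Sum>p\<in>range h - {0}. k p * W (h -` {p}) \<omega>)"
proof -
  let ?P = "range h - {0}" and ?Q = "range (\<lambda>x. k (h x)) - {0}"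
  have fin: "finite ?P" using fin_simple_finite_range[OF h] by auto
  have finQ: "finite ?Q" using fin_simple_finite_range[OF fin_simple_compose[where h = h and k = k, OF assms]] by auto
  have "AE \<omega> in M. \<forall>y\<in>?Q. W ((\<lambda>x. k (h x)) -` {y}) \<omega> = (\<Sum>p\<in>{p\<in>?P. k p = y}. W (h -` {p}) \<omega>)"
  proof (rule AE_finite_allI[OF finQ])
    fix y assume y: "y \<in> ?Q"
    have "(\<lambda>x. k (h x)) -` {y} = (\<Union>p\<in>{p\<in>?P. k p = y}. h -` {p})"
      using y k by auto
    moreover have "AE \<omega> in M. W (\<Union>p\<in>{p\<in>?P. k p = y}. h -` {p}) \<omega>
        = (\<Sum>p\<in>{p\<in>?P. k p = y}. W (h -` {p}) \<omega>)"
      using fin fin_simple_vimage[OF h]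
      by (intro noise_finite_UN) (auto simp: disjoint_family_on_def)
    ultimately show "AE \<omega> in M. W ((\<lambda>x. k (h x)) -` {y}) \<omega>
        = (\<Sum>p\<in>{p\<in>?P. k p = y}. W (h -` {p}) \<omega>)"
      by simp
  qed
  then show ?thesis
  proof eventually_elim
    case (elim \<omega>)
    have "simple_stoch_integral W (\<lambda>x. k (h x)) \<omega>
        = (\<Sum>y\<in>?Q. \<Sum>p\<in>{p\<in>?P. k p = y}. k p * W (h -` {p}) \<omega>)"
      unfolding simple_stoch_integral_def using elim
      by (intro sum.cong refl) (auto simp: sum_distrib_left)
    \<comment> \<open>Each y in \<open>?Q\<close> is nonzero, so levels with \<open>k p = 0\<close>
      may be dropped first; then \<open>k\<close> maps the index set into \<open>?Q\<close>, as
      grouping requires.\<close>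
    also have "\<dots> = (\<Sum>y\<in>?Q. \<Sum>p\<in>{p\<in>{p\<in>?P. k p \<noteq> 0}. k p = y}. k p * W (h -` {p}) \<omega>)"
      by (intro sum.cong refl) auto
    also have "\<dots> = (\<Sum>p\<in>{p\<in>?P. k p \<noteq> 0}. k p * W (h -` {p}) \<omega>)"
      using fin finQ by (intro sum.group) auto
    also have "\<dots> = (\<Sum>p\<in>?P. k p * W (h -` {p}) \<omega>)"
      using fin by (intro sum.mono_neutral_left) auto
    finally show ?case .
  qed
qed

lemma simple_stoch_integral_diff:
  fixes f g :: "real^'d \<Rightarrow> real"
  assumes "fin_simple f" "fin_simple g"
  shows "AE \<omega> in M. simple_stoch_integral W (\<lambda>x. f x - g x) \<omega>
    = simple_stoch_integral W f \<omega> - simple_stoch_integral W g \<omega>"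
proof -
  have E: "AE \<omega> in M. simple_stoch_integral W (\<lambda>x. k (f x, g x)) \<omega>
      = (\<Sum>p\<in>range (\<lambda>x. (f x, g x)) - {0}. k p * W ((\<lambda>x. (f x, g x)) -` {p}) \<omega>)"
    if "k 0 = 0" for k
    by (rule simple_stoch_integral_compose[where k = k, OF fin_simple_Pair[OF assms] that])
  note E[of fst, simplified] E[of snd, simplified] E[of "\<lambda>p. fst p - snd p", simplified]
  then show ?thesis
    by eventually_elim (simp add: sum_subtractf left_diff_distrib)
qed

lemma simple_stoch_integral_measurable:
  fixes f :: "real^'d \<Rightarrow> real"
  assumes "fin_simple f"
  shows "simple_stoch_integral W f \<in> borel_measurable M"
  unfolding simple_stoch_integral_def[abs_def]
  using fin_simple_vimage[OF assms]
  by (intro borel_measurable_sum borel_measurable_times borel_measurable_const noise_measurable) auto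

lemma nn_integral_fin_simple:
  fixes f :: "real^'d \<Rightarrow> real"
  assumes f: "fin_simple f" and "0 < \<alpha>"
  shows "(\<integral>\<^sup>+x. ennreal (\<bar>f x\<bar> powr \<alpha>) \<partial>lborel)
    = ennreal (\<Sum>y\<in>range f - {0}. measure lborel (f -` {y}) * \<bar>y\<bar> powr \<alpha>)"
proof -
  have m: "f -` A \<in> sets borel" for A
    using simple_functionD(2)[of lborel f A] f by (auto simp: fin_simple_def)
  have "(\<integral>\<^sup>+x. ennreal (\<bar>f x\<bar> powr \<alpha>) \<partial>lborel)
      = (\<integral>\<^sup>+x. (\<Sum>y\<in>range f - {0}. ennreal (\<bar>y\<bar> powr \<alpha>) * indicator (f -` {y}) x) \<partial>lborel)"
  proof (intro nn_integral_cong)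
    fix x
    show "ennreal (\<bar>f x\<bar> powr \<alpha>)
        = (\<Sum>y\<in>range f - {0}. ennreal (\<bar>y\<bar> powr \<alpha>) * indicator (f -` {y}) x)"
    proof (cases "f x = 0")
      case False
      then have "(\<Sum>y\<in>range f - {0}. ennreal (\<bar>y\<bar> powr \<alpha>) * indicator (f -` {y}) x)
          = (\<Sum>y\<in>{f x}. ennreal (\<bar>y\<bar> powr \<alpha>) * indicator (f -` {y}) x)"
        using fin_simple_finite_range[OF f]
        by (intro sum.mono_neutral_right) (auto simp: indicator_def)
      then show ?thesis by simp
    qed (use \<open>0 < \<alpha>\<close> in \<open>auto simp: indicator_def intro!: sum.neutral[symmetric]\<close>)
  qed
  also have "\<dots> = (\<Sum>y\<in>range f - {0}. ennreal (\<bar>y\<bar> powr \<alpha>) * emeasure lborel (f -` {y}))"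
    using m by (subst nn_integral_sum) (auto simp: nn_integral_cmult)
  also have "\<dots> = (\<Sum>y\<in>range f - {0}. ennreal (measure lborel (f -` {y}) * \<bar>y\<bar> powr \<alpha>))"
    using fin_simple_vimage[OF f]
    by (intro sum.cong refl) (auto simp: emeasure_eq_ennreal_measure less_top ennreal_mult' mult.commute)
  finally show ?thesis by (simp add: sum_ennreal)
qed

lemma char_simple_stoch_integral:
  fixes f :: "real^'d \<Rightarrow> real"
  assumes f: "fin_simple f" and "0 < \<alpha>" and "0 \<le> I"
    and I: "(\<integral>\<^sup>+x. ennreal (\<bar>f x\<bar> powr \<alpha>) \<partial>lborel) = ennreal I"
  shows "char (distr M borel (simple_stoch_integral W f)) u
    = complex_of_real (exp (- I * \<bar>u\<bar> powr \<alpha>))"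
proof -
  have "(\<Sum>y\<in>range f - {0}. measure lborel (f -` {y}) * \<bar>y\<bar> powr \<alpha>) = I"
    using nn_integral_fin_simple[OF f \<open>0 < \<alpha>\<close>] I \<open>0 \<le> I\<close>
    by (auto simp: sum_nonneg)
  then have "(\<Sum>y\<in>range f - {0}. measure lborel (f -` {y}) * \<bar>u * y\<bar> powr \<alpha>) = I * \<bar>u\<bar> powr \<alpha>"
    by (auto simp: abs_mult powr_mult sum_distrib_left mult_ac)
  moreover have "char (distr M borel (\<lambda>\<omega>. \<Sum>y\<in>range f - {0}. y * W (f -` {y}) \<omega>)) u
      = complex_of_real (exp (- (\<Sum>y\<in>range f - {0}. measure lborel (f -` {y}) * \<bar>u * y\<bar> powr \<alpha>)))"
    using fin_simple_finite_range[OF f] fin_simple_vimage[OF f]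
    by (intro char_noise_sum) (auto simp: disjoint_family_on_def)
  ultimately show ?thesis
    unfolding simple_stoch_integral_def[abs_def] by simp
qed

end

section \<open>From existence of the integral to \<alpha>-integrability; tails of stable
  variables\<close>

context stable_white_noise
begin

text \<open>The characteristic functions \<open>exp (- I n * \<bar>u\<bar> powr \<alpha>)\<close>
  converge to one that is continuous with value 1 at 0. This keeps the scales \<open>I n\<close>
  from escaping to infinity and forces them to converge; Fatou's lemma then bounds the integral of
  \<open>f\<close>. Only an inequality is recorded, which is enough to rule out integrals.\<close>

lemma has_stoch_integral_char:
  fixes f :: "real^'d \<Rightarrow> real"
  assumes f: "has_stoch_integral M W f X" and "0 < \<alpha>"
  shows "\<exists>I\<ge>0. (\<integral>\<^sup>+x. ennreal (\<bar>f x\<bar> powr \<alpha>) \<partial>lborel) \<le> ennreal I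
    \<and> (\<forall>u. char (distr M borel X) u = complex_of_real (exp (- I * \<bar>u\<bar> powr \<alpha>)))"
proof -
  obtain F where F: "\<And>n. fin_simple (F n)" and lim: "AE x in lborel. (\<lambda>n. F n x) \<longlonglongrightarrow> f x"
    and conv: "converges_in_prob M (\<lambda>n. simple_stoch_integral W (F n)) X"
    and [measurable]: "X \<in> borel_measurable M" "f \<in> borel_measurable borel"
    using f unfolding has_stoch_integral_def fin_simple_def by blast
  have [measurable]: "F n \<in> borel_measurable borel" for n
    using F[of n] by (auto simp: fin_simple_def dest: borel_measurable_simple_function)
  define I where "I n = (\<Sum>y\<in>range (F n) - {0}. measure lborel (F n -` {y}) * \<bar>y\<bar> powr \<alpha>)" for n
  have I: "0 \<le> I n" "(\<integral>\<^sup>+x. ennreal (\<bar>F n x\<bar> powr \<alpha>) \<partial>lborel) = ennreal (I n)" for n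
    using nn_integral_fin_simple[OF F \<open>0 < \<alpha>\<close>] by (auto simp: I_def intro!: sum_nonneg)
  have char: "(\<lambda>n. complex_of_real (exp (- I n * \<bar>u\<bar> powr \<alpha>))) \<longlonglongrightarrow> char (distr M borel X) u" for u
    using converges_in_prob_char[OF conv simple_stoch_integral_measurable[OF F], of u]
      char_simple_stoch_integral[OF F \<open>0 < \<alpha>\<close> I] by simp
  interpret D: real_distribution "distr M borel X"
    by (rule real_distribution_distr) simp
  have "\<forall>\<^sub>F u in at (0::real). dist (char (distr M borel X) u) 1 < 1"
    using D.isCont_char[of 0] unfolding isCont_def D.char_zero by (rule tendstoD) simp
  then obtain d where "d > 0" and d: "\<And>u. u \<noteq> 0 \<Longrightarrow> dist u 0 < d \<Longrightarrow> dist (char (distr M borel X) u) 1 < 1"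
    unfolding eventually_at by auto
  define v where "v = d / 2"
  have "v > 0" and v: "dist (char (distr M borel X) v) 1 < 1"
    using \<open>d > 0\<close> d[of v] by (auto simp: v_def)
  then have "char (distr M borel X) v \<noteq> 0" by auto
  define e where "e = Re (char (distr M borel X) v)"
  have elim: "(\<lambda>n. exp (- I n * v powr \<alpha>)) \<longlonglongrightarrow> e"
    using tendsto_Re[OF char[of v]] \<open>v > 0\<close> by (simp add: e_def del: of_real_exp)
  have "e > 0"
  proof -
    have "\<bar>Re (char (distr M borel X) v - 1)\<bar> < 1"
      using v abs_Re_le_cmod[of "char (distr M borel X) v - 1"] by (simp add: dist_norm)
    then show ?thesis by (simp add: e_def)
  qed
  \<comment> \<open>Solving \<open>exp (- J * v powr \<alpha>) = e\<close> for \<open>J\<close>,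
    possible because e > 0, turns the limit at the single point \<open>v\<close> into the limit of
    the scales.\<close>
  define J where "J = - ln e / v powr \<alpha>"
  have "(\<lambda>n. - ln (exp (- I n * v powr \<alpha>)) / v powr \<alpha>) \<longlonglongrightarrow> J"
    unfolding J_def using elim \<open>e > 0\<close> \<open>v > 0\<close> by (intro tendsto_intros) auto
  then have J: "I \<longlonglongrightarrow> J" using \<open>v > 0\<close> by simp
  then have "J \<ge> 0" using I(1) by (intro LIMSEQ_le_const) auto
  have "(\<integral>\<^sup>+x. ennreal (\<bar>f x\<bar> powr \<alpha>) \<partial>lborel)
      \<le> (\<integral>\<^sup>+x. liminf (\<lambda>n. ennreal (\<bar>F n x\<bar> powr \<alpha>)) \<partial>lborel)"
  proof (rule nn_integral_mono_AE, use lim in eventually_elim)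
    case (elim x)
    have "(\<lambda>n. ennreal (\<bar>F n x\<bar> powr \<alpha>)) \<longlonglongrightarrow> ennreal (\<bar>f x\<bar> powr \<alpha>)"
      using elim \<open>0 < \<alpha>\<close> by (intro tendsto_ennrealI tendsto_powr2 tendsto_intros) auto
    from lim_imp_Liminf[OF trivial_limit_sequentially this] show ?case by simp
  qed
  also have "\<dots> \<le> liminf (\<lambda>n. \<integral>\<^sup>+x. ennreal (\<bar>F n x\<bar> powr \<alpha>) \<partial>lborel)"
    by (rule nn_integral_liminf) simp
  also have "\<dots> = ennreal J"
    unfolding I by (intro lim_imp_Liminf tendsto_ennrealI J) simp
  finally have 1: "(\<integral>\<^sup>+x. ennreal (\<bar>f x\<bar> powr \<alpha>) \<partial>lborel) \<le> ennreal J" .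
  have "char (distr M borel X) u = complex_of_real (exp (- J * \<bar>u\<bar> powr \<alpha>))" for u
  proof (rule LIMSEQ_unique[OF char])
    show "(\<lambda>n. complex_of_real (exp (- I n * \<bar>u\<bar> powr \<alpha>)))
        \<longlonglongrightarrow> complex_of_real (exp (- J * \<bar>u\<bar> powr \<alpha>))"
      using J by (intro tendsto_of_real tendsto_intros) auto
  qed
  with 1 \<open>J \<ge> 0\<close> show ?thesis by blast
qed

text \<open>A variable with scale c has the law of \<open>c powr (1 / \<alpha>)\<close> times the
  noise of a unit cube, by uniqueness of characteristic functions. Hence tails are small uniformly
  over all variables of small scale.\<close>

lemma stable_tail_small:
  assumes "0 < \<alpha>" "0 < \<epsilon>" "0 < \<eta>"
  shows "\<exists>c0>0. \<forall>Z c. Z \<in> borel_measurable M \<longrightarrow> 0 \<le> c \<longrightarrow> c < c0 \<longrightarrow>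
    (\<forall>u. char (distr M borel Z) u = complex_of_real (exp (- c * \<bar>u\<bar> powr \<alpha>))) \<longrightarrow>
    prob {\<omega> \<in> space M. \<epsilon> < \<bar>Z \<omega>\<bar>} < \<eta>"
proof -
  define U where "U = cbox (0 :: real^'d) One"
  have U: "U \<in> sets borel" "emeasure lborel U < \<infinity>" "measure lborel U = 1"
    by (auto simp: U_def emeasure_lborel_cbox_eq)
  define Z1 where "Z1 = W U"
  have [measurable]: "Z1 \<in> borel_measurable M"
    unfolding Z1_def using U by (intro noise_measurable)
  have Z1: "char (distr M borel Z1) u = complex_of_real (exp (- (\<bar>u\<bar> powr \<alpha>)))" for u
    unfolding Z1_def using noise_char[OF U(1,2)] U(3) by simp
  obtain N :: nat where N: "prob {\<omega> \<in> space M. real N < \<bar>Z1 \<omega>\<bar>} < \<eta>"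
    using order_tendstoD(2)[OF prob_abs_gt_tendsto_0[of Z1] \<open>0 < \<eta>\<close>]
    unfolding eventually_sequentially by auto
  \<comment> \<open>Scales below \<open>c0\<close> give a factor \<open>s\<close> with
    \<open>s * (real N + 1) \<le> \<epsilon>\<close>; the 1 covers N = 0.\<close>
  define c0 where "c0 = (\<epsilon> / (real N + 1)) powr \<alpha>"
  have "c0 > 0" using assms by (auto simp: c0_def add_nonneg_eq_0_iff)
  have "prob {\<omega> \<in> space M. \<epsilon> < \<bar>Z \<omega>\<bar>} < \<eta>"
    if [measurable]: "Z \<in> borel_measurable M" and c: "0 \<le> c" "c < c0"
      and Z: "\<And>u. char (distr M borel Z) u = complex_of_real (exp (- c * \<bar>u\<bar> powr \<alpha>))" for Z c
  proof -
    define s where "s = c powr (1 / \<alpha>)"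
    have "s \<ge> 0" and s: "s powr \<alpha> = c"
      using c assms by (auto simp: s_def powr_powr)
    have "s \<le> c0 powr (1 / \<alpha>)"
      unfolding s_def using c assms by (intro powr_mono2) auto
    also have "\<dots> = \<epsilon> / (real N + 1)"
      unfolding c0_def using assms by (simp add: powr_powr)
    finally have s_le: "s * (real N + 1) \<le> \<epsilon>" by (simp add: field_simps)
    have "char (distr M borel (\<lambda>\<omega>. s * Z1 \<omega>)) u = char (distr M borel Z) u" for u
    proof -
      have "char (distr M borel (\<lambda>\<omega>. s * Z1 \<omega>)) u = char (distr M borel Z1) (u * s)"
        by (simp add: char_distr mult.assoc)
      also have "\<dots> = char (distr M borel Z) u"
        using \<open>s \<ge> 0\<close> by (simp add: Z1 Z abs_mult powr_mult s mult.commute)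
      finally show ?thesis .
    qed
    then have eq: "distr M borel (\<lambda>\<omega>. s * Z1 \<omega>) = distr M borel Z"
      by (intro Levy_uniqueness real_distribution_distr ext) auto
    have "prob {\<omega> \<in> space M. \<epsilon> < \<bar>Z \<omega>\<bar>} = measure (distr M borel Z) {z. \<epsilon> < \<bar>z\<bar>}"
      by (subst measure_distr) (auto intro!: arg_cong[where f = "measure M"])
    also have "\<dots> = prob {\<omega> \<in> space M. \<epsilon> < \<bar>s * Z1 \<omega>\<bar>}"
      unfolding eq[symmetric] by (subst measure_distr) (auto intro!: arg_cong[where f = "measure M"])
    also have "\<dots> \<le> prob {\<omega> \<in> space M. real N < \<bar>Z1 \<omega>\<bar>}"
    proof (rule finite_measure_mono)
      show "{\<omega> \<in> space M. \<epsilon> < \<bar>s * Z1 \<omega>\<bar>} \<subseteq> {\<omega> \<in> space M. real N < \<bar>Z1 \<omega>\<bar>}"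
      proof (safe, rule ccontr)
        fix \<omega> assume "\<epsilon> < \<bar>s * Z1 \<omega>\<bar>" "\<not> real N < \<bar>Z1 \<omega>\<bar>"
        then have "\<bar>s * Z1 \<omega>\<bar> \<le> s * (real N + 1)"
          using \<open>s \<ge> 0\<close> by (auto simp: abs_mult intro!: mult_left_mono)
        then show False using s_le \<open>\<epsilon> < \<bar>s * Z1 \<omega>\<bar>\<close> by simp
      qed
    qed simp
    finally show ?thesis using N by simp
  qed
  with \<open>c0 > 0\<close> show ?thesis by blast
qed

end

section \<open>From \<alpha>-integrability to existence of the integral\<close>

text \<open>A substitute for the triangle inequality that also covers \<alpha> < 1: a difference is
  at most twice the larger of the two absolute values.\<close>

lemma abs_diff_powr_le:
  fixes a b \<alpha> :: real
  assumes "0 \<le> \<alpha>"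
  shows "\<bar>a - b\<bar> powr \<alpha> \<le> 2 powr \<alpha> * (\<bar>a\<bar> powr \<alpha> + \<bar>b\<bar> powr \<alpha>)"
proof -
  have "\<bar>a - b\<bar> powr \<alpha> \<le> (2 * max \<bar>a\<bar> \<bar>b\<bar>) powr \<alpha>"
    using assms by (intro powr_mono2) auto
  also have "\<dots> = 2 powr \<alpha> * max \<bar>a\<bar> \<bar>b\<bar> powr \<alpha>" by (simp add: powr_mult)
  also have "\<dots> \<le> 2 powr \<alpha> * (\<bar>a\<bar> powr \<alpha> + \<bar>b\<bar> powr \<alpha>)"
    by (intro mult_left_mono) (auto simp: max_def)
  finally show ?thesis .
qed

text \<open>Simple approximations bounded by twice \<open>\<bar>f x\<bar>\<close> are cut off to
  growing balls, which makes their supports finite in measure. The error is then at most three times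
  \<open>\<bar>f x\<bar>\<close>, and dominated convergence applies.\<close>

lemma Lp_simple_approximation:
  fixes f :: "real^'d \<Rightarrow> real"
  assumes [measurable]: "f \<in> borel_measurable borel" and "0 < \<alpha>"
    and fin: "(\<integral>\<^sup>+x. ennreal (\<bar>f x\<bar> powr \<alpha>) \<partial>lborel) < \<infinity>"
  shows "\<exists>F. (\<forall>n. fin_simple (F n)) \<and> (\<forall>x. (\<lambda>n. F n x) \<longlonglongrightarrow> f x) \<and>
    (\<lambda>n. \<integral>\<^sup>+x. ennreal (\<bar>F n x - f x\<bar> powr \<alpha>) \<partial>lborel) \<longlonglongrightarrow> 0"
proof -
  obtain G where G: "\<And>n. simple_function lborel (G n)"
      "\<And>x. (\<lambda>n. G n x) \<longlonglongrightarrow> f x" "\<And>n x. \<bar>G n x\<bar> \<le> 2 * \<bar>f x\<bar>"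
    using borel_measurable_implies_sequence_metric[of f lborel 0] by (auto simp: dist_norm)
  define F where "F n x = indicator (cball 0 (real n)) x * G n x" for n x
  have "fin_simple (F n)" for n
  proof -
    have s: "simple_function lborel (F n)"
      unfolding F_def[abs_def] by (intro simple_function_mult simple_function_indicator G) auto
    have "{x. F n x \<noteq> 0} \<in> sets lborel"
      using simple_functionD(2)[OF s, of "-{0}"] by (simp add: vimage_def Compl_eq)
    then have "emeasure lborel {x. F n x \<noteq> 0} \<le> emeasure lborel (cball (0 :: real^'d) (real n))"
      by (intro emeasure_mono) (auto simp: F_def indicator_def split: if_splits)
    then show ?thesis
      using s emeasure_lborel_cball_finite[of "0 :: real^'d" "real n"]
      by (auto simp: fin_simple_def)
  qed
  moreover have F: "(\<lambda>n. F n x) \<longlonglongrightarrow> f x" for x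
  proof (rule Lim_transform_eventually[OF G(2)])
    obtain N :: nat where "norm x \<le> real N" using real_arch_simple by blast
    then show "\<forall>\<^sub>F n in sequentially. G n x = F n x"
      unfolding eventually_sequentially F_def by (auto intro!: exI[of _ N])
  qed
  moreover have "(\<lambda>n. \<integral>\<^sup>+x. ennreal (\<bar>F n x - f x\<bar> powr \<alpha>) \<partial>lborel) \<longlonglongrightarrow> (\<integral>\<^sup>+x. 0 \<partial>(lborel::(real^'d) measure))"
  proof (rule nn_integral_dominated_convergence)
    have [measurable]: "G n \<in> borel_measurable borel" for n
      using G(1)[of n] by (auto dest: borel_measurable_simple_function)
    have [measurable]: "cball 0 (real n) \<in> sets (borel :: (real^'d) measure)" for n
      by simp
    show "(\<lambda>x. ennreal (\<bar>F n x - f x\<bar> powr \<alpha>)) \<in> borel_measurable lborel" for n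
      unfolding F_def by measurable
    show "(\<lambda>x. ennreal (3 powr \<alpha>) * ennreal (\<bar>f x\<bar> powr \<alpha>)) \<in> borel_measurable lborel"
      by measurable
    show "(\<integral>\<^sup>+x. ennreal (3 powr \<alpha>) * ennreal (\<bar>f x\<bar> powr \<alpha>) \<partial>lborel) < \<infinity>"
      using fin by (simp add: nn_integral_cmult ennreal_mult_less_top)
    show "AE x in lborel. ennreal (\<bar>F n x - f x\<bar> powr \<alpha>) \<le> ennreal (3 powr \<alpha>) * ennreal (\<bar>f x\<bar> powr \<alpha>)" for n
    proof (intro AE_I2)
      fix x
      have "\<bar>F n x - f x\<bar> \<le> 3 * \<bar>f x\<bar>"
        using G(3)[of n x] by (auto simp: F_def indicator_def)
      then have "\<bar>F n x - f x\<bar> powr \<alpha> \<le> (3 * \<bar>f x\<bar>) powr \<alpha>"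
        using \<open>0 < \<alpha>\<close> by (intro powr_mono2) auto
      then show "ennreal (\<bar>F n x - f x\<bar> powr \<alpha>) \<le> ennreal (3 powr \<alpha>) * ennreal (\<bar>f x\<bar> powr \<alpha>)"
        by (simp add: powr_mult ennreal_mult'[symmetric] ennreal_leI)
    qed
    show "AE x in lborel. (\<lambda>n. ennreal (\<bar>F n x - f x\<bar> powr \<alpha>)) \<longlonglongrightarrow> 0"
    proof (intro AE_I2)
      fix x
      have "(\<lambda>n. ennreal (\<bar>F n x - f x\<bar> powr \<alpha>)) \<longlonglongrightarrow> ennreal (\<bar>f x - f x\<bar> powr \<alpha>)"
        using F[of x] \<open>0 < \<alpha>\<close> by (intro tendsto_ennrealI tendsto_powr2 tendsto_intros) auto
      then show "(\<lambda>n. ennreal (\<bar>F n x - f x\<bar> powr \<alpha>)) \<longlonglongrightarrow> 0" by simp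
    qed
  qed auto
  ultimately show ?thesis by (intro exI[of _ F]) auto
qed

context stable_white_noise
begin

text \<open>The integrals over any Borel set are Cauchy in probability: their differences are
  integrals of simple functions whose scale is small by the L^\<alpha> approximation, and a small
  scale means small tails.\<close>

lemma has_stoch_integral_exists:
  fixes f :: "real^'d \<Rightarrow> real"
  assumes [measurable]: "f \<in> borel_measurable borel" and "0 < \<alpha>"
    and fin: "(\<integral>\<^sup>+x. ennreal (\<bar>f x\<bar> powr \<alpha>) \<partial>lborel) < \<infinity>"
  shows "\<exists>X. has_stoch_integral M W f X"
proof -
  obtain F where F: "\<And>n. fin_simple (F n)" and lim: "\<And>x. (\<lambda>n. F n x) \<longlonglongrightarrow> f x"
    and L: "(\<lambda>n. \<integral>\<^sup>+x. ennreal (\<bar>F n x - f x\<bar> powr \<alpha>) \<partial>lborel) \<longlonglongrightarrow> 0"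
    using Lp_simple_approximation[OF assms] by blast
  have [measurable]: "F n \<in> borel_measurable borel" for n
    using F[of n] by (auto simp: fin_simple_def dest: borel_measurable_simple_function)
  have conv: "\<exists>Y\<in>borel_measurable M. converges_in_prob M
      (\<lambda>n. simple_stoch_integral W (\<lambda>x. indicator A x * F n x)) Y"
    if A[measurable]: "A \<in> sets borel" for A
  proof (rule Cauchy_in_prob_imp_converges)
    let ?G = "\<lambda>n x. indicator A x * F n x"
    have G: "fin_simple (?G n)" for n
    proof -
      have s: "simple_function lborel (?G n)"
        using F[of n] A unfolding fin_simple_def by (intro simple_function_mult simple_function_indicator) auto
      have "emeasure lborel {x. ?G n x \<noteq> 0} \<le> emeasure lborel {x. F n x \<noteq> 0}"
        by (intro emeasure_mono) auto
      then show ?thesis using s F[of n] by (auto simp: fin_simple_def)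
    qed
    show "simple_stoch_integral W (?G n) \<in> borel_measurable M" for n
      by (rule simple_stoch_integral_measurable[OF G])
    fix \<epsilon> \<eta> :: real assume "0 < \<epsilon>" "0 < \<eta>"
    obtain c0 where "c0 > 0" and c0: "\<And>Z c. Z \<in> borel_measurable M \<Longrightarrow> 0 \<le> c \<Longrightarrow> c < c0 \<Longrightarrow>
        (\<forall>u. char (distr M borel Z) u = complex_of_real (exp (- c * \<bar>u\<bar> powr \<alpha>))) \<Longrightarrow>
        prob {\<omega> \<in> space M. \<epsilon> < \<bar>Z \<omega>\<bar>} < \<eta>"
      using stable_tail_small[OF \<open>0 < \<alpha>\<close> \<open>0 < \<epsilon>\<close> \<open>0 < \<eta>\<close>] by blast
    \<comment> \<open>Chosen such that \<open>2 powr \<alpha> * (b + b)\<close> is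
      \<open>c0 / 2\<close>.\<close>
    define b where "b = c0 / (4 * 2 powr \<alpha>)"
    have "b > 0" using \<open>c0 > 0\<close> by (simp add: b_def)
    then have "\<forall>\<^sub>F n in sequentially. (\<integral>\<^sup>+x. ennreal (\<bar>F n x - f x\<bar> powr \<alpha>) \<partial>lborel) < ennreal b"
      by (intro order_tendstoD(2)[OF L]) auto
    then obtain N where N: "\<And>n. n \<ge> N \<Longrightarrow> (\<integral>\<^sup>+x. ennreal (\<bar>F n x - f x\<bar> powr \<alpha>) \<partial>lborel) < ennreal b"
      unfolding eventually_sequentially by auto
    have "prob {\<omega> \<in> space M. \<epsilon> < \<bar>simple_stoch_integral W (?G m) \<omega> - simple_stoch_integral W (?G n) \<omega>\<bar>} < \<eta>"
      if mn: "m \<ge> N" "n \<ge> N" for m n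
    proof -
      let ?D = "\<lambda>x. ?G m x - ?G n x"
      have D: "fin_simple ?D"
        using fin_simple_compose[OF fin_simple_Pair[OF G G], of "\<lambda>p. fst p - snd p"] by simp
      have "(\<integral>\<^sup>+x. ennreal (\<bar>?D x\<bar> powr \<alpha>) \<partial>lborel)
          \<le> (\<integral>\<^sup>+x. ennreal (2 powr \<alpha>) * (ennreal (\<bar>F m x - f x\<bar> powr \<alpha>)
              + ennreal (\<bar>F n x - f x\<bar> powr \<alpha>)) \<partial>lborel)"
      proof (rule nn_integral_mono)
        fix x
        have "\<bar>?D x\<bar> powr \<alpha> \<le> \<bar>(F m x - f x) - (F n x - f x)\<bar> powr \<alpha>"
          using \<open>0 < \<alpha>\<close> by (auto simp: indicator_def)
        also have "\<dots> \<le> 2 powr \<alpha> * (\<bar>F m x - f x\<bar> powr \<alpha> + \<bar>F n x - f x\<bar> powr \<alpha>)"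
          using \<open>0 < \<alpha>\<close> by (intro abs_diff_powr_le) auto
        finally show "ennreal (\<bar>?D x\<bar> powr \<alpha>) \<le> ennreal (2 powr \<alpha>) * (ennreal (\<bar>F m x - f x\<bar> powr \<alpha>)
              + ennreal (\<bar>F n x - f x\<bar> powr \<alpha>))"
          by (simp add: ennreal_mult'[symmetric] ennreal_plus[symmetric] ennreal_leI del: ennreal_plus)
      qed
      also have "\<dots> = ennreal (2 powr \<alpha>) * ((\<integral>\<^sup>+x. ennreal (\<bar>F m x - f x\<bar> powr \<alpha>) \<partial>lborel)
              + (\<integral>\<^sup>+x. ennreal (\<bar>F n x - f x\<bar> powr \<alpha>) \<partial>lborel))"
        by (simp add: nn_integral_cmult nn_integral_add)
      also have "\<dots> \<le> ennreal (2 powr \<alpha>) * (ennreal b + ennreal b)"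
        using N mn by (intro mult_left_mono add_mono) (auto intro: less_imp_le)
      also have "\<dots> = ennreal (c0 / 2)"
        using \<open>b > 0\<close> by (simp add: ennreal_mult'[symmetric] ennreal_plus[symmetric] b_def del: ennreal_plus)
      finally have le: "(\<integral>\<^sup>+x. ennreal (\<bar>?D x\<bar> powr \<alpha>) \<partial>lborel) \<le> ennreal (c0 / 2)" .
      then obtain c where c: "0 \<le> c" "(\<integral>\<^sup>+x. ennreal (\<bar>?D x\<bar> powr \<alpha>) \<partial>lborel) = ennreal c"
        by (cases "\<integral>\<^sup>+x. ennreal (\<bar>?D x\<bar> powr \<alpha>) \<partial>lborel" rule: ennreal_cases)
          (auto simp: top_unique)
      have "c < c0" using le c \<open>c0 > 0\<close> by simp
      have "prob {\<omega> \<in> space M. \<epsilon> < \<bar>simple_stoch_integral W ?D \<omega>\<bar>} < \<eta>"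
        using c \<open>c < c0\<close> char_simple_stoch_integral[OF D \<open>0 < \<alpha>\<close> c]
        by (intro c0[of _ c] simple_stoch_integral_measurable[OF D]) auto
      moreover have "prob {\<omega> \<in> space M. \<epsilon> < \<bar>simple_stoch_integral W (?G m) \<omega> - simple_stoch_integral W (?G n) \<omega>\<bar>}
          = prob {\<omega> \<in> space M. \<epsilon> < \<bar>simple_stoch_integral W ?D \<omega>\<bar>}"
      proof (rule finite_measure_eq_AE)
        show "AE \<omega> in M. (\<omega> \<in> {\<omega> \<in> space M. \<epsilon> < \<bar>simple_stoch_integral W (?G m) \<omega> - simple_stoch_integral W (?G n) \<omega>\<bar>})
            \<longleftrightarrow> (\<omega> \<in> {\<omega> \<in> space M. \<epsilon> < \<bar>simple_stoch_integral W ?D \<omega>\<bar>})"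
          using simple_stoch_integral_diff[OF G[of m] G[of n]] by eventually_elim simp
      qed (use simple_stoch_integral_measurable[OF D] simple_stoch_integral_measurable[OF G] in measurable)
      ultimately show ?thesis by simp
    qed
    then show "\<exists>N. \<forall>m\<ge>N. \<forall>n\<ge>N. prob {\<omega> \<in> space M. \<epsilon> <
        \<bar>simple_stoch_integral W (?G m) \<omega> - simple_stoch_integral W (?G n) \<omega>\<bar>} < \<eta>"
      by blast
  qed
  \<comment> \<open>The whole space as Borel set yields the integral itself.\<close>
  obtain X where "X \<in> borel_measurable M" "converges_in_prob M (\<lambda>n. simple_stoch_integral W (F n)) X"
    using conv[of UNIV] by auto
  then show ?thesis
    unfolding has_stoch_integral_def using conv lim F
    by (intro exI[of _ X]) (auto simp: fin_simple_def intro!: exI[of _ F])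
qed

end

section \<open>Integrability of powers of the norm near 0 and near infinity\<close>

section \<open>Powers of the norm\<close>

lemma nn_integral_scaleR:
  fixes f :: "'a::euclidean_space \<Rightarrow> ennreal"
  assumes [measurable]: "f \<in> borel_measurable borel" and "0 < c"
  shows "(\<integral>\<^sup>+x. f x \<partial>lborel) = ennreal (c ^ DIM('a)) * (\<integral>\<^sup>+x. f (c *\<^sub>R x) \<partial>lborel)"
  by (subst lborel_affine[of c 0]) (use \<open>0 < c\<close> in \<open>auto simp: nn_integral_density nn_integral_distr nn_integral_cmult\<close>)

lemma nn_integral_translate:
  fixes f :: "'a::euclidean_space \<Rightarrow> ennreal"
  assumes [measurable]: "f \<in> borel_measurable borel"
  shows "(\<integral>\<^sup>+x. f (x - a) \<partial>lborel) = (\<integral>\<^sup>+x. f x \<partial>lborel)"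
proof -
  have "(\<integral>\<^sup>+x. f x \<partial>lborel) = (\<integral>\<^sup>+x. f x \<partial>(distr lborel borel (\<lambda>x. - a + x)))"
    by (rule arg_cong[OF lborel_distr_plus[of "- a"], of "\<lambda>N. nn_integral N f", symmetric])
  also have "\<dots> = (\<integral>\<^sup>+x. f (x - a) \<partial>lborel)"
    by (subst nn_integral_distr) auto
  finally show ?thesis by simp
qed

lemma suminf_ennreal_ge_const:
  fixes f :: "nat \<Rightarrow> ennreal"
  assumes "0 < a" "\<And>k. a \<le> f k"
  shows "(\<Sum>k. f k) = \<infinity>"
proof (rule ccontr)
  assume "(\<Sum>k. f k) \<noteq> \<infinity>"
  then obtain s where s: "0 \<le> s" "(\<Sum>k. f k) = ennreal s"
    by (cases "\<Sum>k. f k" rule: ennreal_cases) auto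
  \<comment> \<open>The minimum with 1 gives a real lower bound even if \<open>a\<close> is
    infinite.\<close>
  obtain b where b: "0 \<le> b" "min a 1 = ennreal b"
    by (cases "min a 1" rule: ennreal_cases) (auto simp: min_def top_unique split: if_splits)
  have "b > 0" using assms(1) b by (cases "b = 0") (auto simp: min_def split: if_splits)
  have "real n * b \<le> s" for n
  proof -
    have "ennreal (real n * b) = (\<Sum>k<n. ennreal b)"
      using b(1) by (simp add: ennreal_mult' ennreal_of_nat_eq_real_of_nat)
    also have "\<dots> \<le> (\<Sum>k<n. f k)"
      using assms(2) b(2) by (intro sum_mono) (metis min.cobounded1 order_trans)
    also have "\<dots> \<le> ennreal s"
      unfolding s(2)[symmetric] by (rule sum_le_suminf) auto
    finally show ?thesis using s(1) by simp
  qed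
  moreover obtain n where "s < real n * b"
    using reals_Archimedean3[OF \<open>b > 0\<close>] by blast
  ultimately show False by (meson leD)
qed

lemma suminf_ennreal_geometric:
  assumes "0 < a" "a < \<infinity>" "0 \<le> q"
  shows "(\<Sum>k. ennreal (q ^ k) * a) < \<infinity> \<longleftrightarrow> q < 1"
proof (cases "q < 1")
  case True
  have "(\<Sum>k. ennreal (q ^ k)) = ennreal (1 / (1 - q))"
    using True assms by (intro suminf_ennreal_eq geometric_sums) auto
  then have "(\<Sum>k. ennreal (q ^ k) * a) = ennreal (1 / (1 - q)) * a"
    by (simp add: ennreal_suminf_multc)
  then show ?thesis using True assms by (simp add: ennreal_mult_less_top)
next
  case False
  have "a \<le> ennreal (q ^ k) * a" for k
    using False mult_right_mono[of 1 "ennreal (q ^ k)" a] by (simp add: one_le_power)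
  then have "(\<Sum>k. ennreal (q ^ k) * a) = \<infinity>"
    by (rule suminf_ennreal_ge_const[OF assms(1)])
  then show ?thesis using False by simp
qed

text \<open>Closed inside and open outside, so that shells whose radii double are disjoint and leave
  no gap between them.\<close>

definition annulus :: "real \<Rightarrow> 'a::euclidean_space set" where
  "annulus s = {x. s \<le> norm x \<and> norm x < 2 * s}"

lemma annulus_sets [measurable, simp]: "annulus s \<in> sets borel"
  unfolding annulus_def by measurable

lemma annulus_power_integral:
  fixes s p :: real
  assumes "0 < s" "0 \<le> p"
  shows "0 < (\<integral>\<^sup>+x. ennreal (norm x powr - p) * indicator (annulus s) (x::'a::euclidean_space) \<partial>lborel)"
    and "(\<integral>\<^sup>+x. ennreal (norm x powr - p) * indicator (annulus s) (x::'a) \<partial>lborel) < \<infinity>"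
proof -
  let ?I = "\<integral>\<^sup>+x. ennreal (norm x powr - p) * indicator (annulus s) (x::'a) \<partial>lborel"
  let ?A = "annulus s :: 'a set"
  have "?A \<subseteq> cball 0 (2 * s)" by (auto simp: annulus_def)
  then have "emeasure lborel ?A \<le> emeasure lborel (cball (0::'a) (2 * s))"
    by (intro emeasure_mono) auto
  also have "\<dots> < \<infinity>" by (rule emeasure_lborel_cball_finite)
  finally have fin: "emeasure lborel ?A < \<infinity>" .
  obtain b :: 'a where b: "b \<in> Basis" using nonempty_Basis by blast
  \<comment> \<open>A point halfway between the two spheres; the ball of radius s/2 around it lies
    in the shell and gives it positive measure.\<close>
  define c where "c = (3 / 2 * s) *\<^sub>R b"
  have nc: "norm c = 3 / 2 * s" using b assms by (simp add: c_def)
  have "ball c (s / 2) \<subseteq> ?A"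
  proof
    fix x assume "x \<in> ball c (s / 2)"
    then have "norm (c - x) < s / 2" by (simp add: dist_norm)
    then show "x \<in> ?A"
      using norm_triangle_ineq2[of c x] norm_triangle_ineq2[of x c] nc
      by (auto simp: annulus_def norm_minus_commute)
  qed
  then have "emeasure lborel (ball c (s / 2)) \<le> emeasure lborel ?A"
    by (intro emeasure_mono) auto
  moreover have "0 < emeasure lborel (ball c (s / 2))"
    using content_ball_pos[of "s / 2" c] assms
    by (auto simp: measure_def zero_less_iff_neq_zero)
  ultimately have pos: "0 < emeasure lborel ?A" by simp
  have "?I \<le> (\<integral>\<^sup>+x. ennreal (s powr - p) * indicator ?A x \<partial>lborel)"
    using assms by (intro nn_integral_mono) (auto simp: annulus_def indicator_def intro!: ennreal_leI powr_mono2')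
  also have "\<dots> < \<infinity>" using fin by (simp add: nn_integral_cmult ennreal_mult_less_top)
  finally show "?I < \<infinity>" .
  have "0 < ennreal ((2 * s) powr - p) * emeasure lborel ?A"
    using pos assms by (simp add: ennreal_zero_less_mult_iff)
  also have "\<dots> = (\<integral>\<^sup>+x. ennreal ((2 * s) powr - p) * indicator ?A x \<partial>lborel)"
    by (simp add: nn_integral_cmult)
  also have "\<dots> \<le> ?I"
    using assms by (intro nn_integral_mono) (auto simp: annulus_def indicator_def intro!: ennreal_leI powr_mono2')
  finally show "0 < ?I" .
qed

text \<open>The change of variables contributes \<open>c ^ DIM('a)\<close> and the integrand
  contributes \<open>c powr - p\<close>.\<close>

lemma annulus_power_integral_scale:
  fixes s p c :: real
  assumes "0 < c"
  shows "(\<integral>\<^sup>+x. ennreal (norm x powr - p) * indicator (annulus (c * s)) (x::'a::euclidean_space) \<partial>lborel)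
    = ennreal (c powr (real DIM('a) - p)) *
      (\<integral>\<^sup>+x. ennreal (norm x powr - p) * indicator (annulus s) (x::'a) \<partial>lborel)"
proof -
  have "(\<integral>\<^sup>+x. ennreal (norm x powr - p) * indicator (annulus (c * s)) (x::'a) \<partial>lborel)
      = ennreal (c ^ DIM('a)) *
        (\<integral>\<^sup>+x. ennreal (norm (c *\<^sub>R x) powr - p) * indicator (annulus (c * s)) (c *\<^sub>R x :: 'a) \<partial>lborel)"
    by (rule nn_integral_scaleR[OF _ assms]) measurable
  also have "(\<integral>\<^sup>+x. ennreal (norm (c *\<^sub>R x) powr - p) * indicator (annulus (c * s)) (c *\<^sub>R x :: 'a) \<partial>lborel)
      = (\<integral>\<^sup>+x. ennreal (c powr - p) * (ennreal (norm x powr - p) * indicator (annulus s) (x::'a)) \<partial>lborel)"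
    using assms
    by (intro nn_integral_cong)
       (auto simp: annulus_def indicator_def powr_mult ennreal_mult' mult.left_commute[of 2 c])
  also have "\<dots> = ennreal (c powr - p) * (\<integral>\<^sup>+x. ennreal (norm x powr - p) * indicator (annulus s) (x::'a) \<partial>lborel)"
    by (rule nn_integral_cmult) measurable
  finally show ?thesis
    using assms by (simp add: ennreal_mult'[symmetric] mult.assoc[symmetric] powr_diff powr_minus
        powr_realpow divide_inverse)
qed

text \<open>By scaling, the integral is a geometric series with ratio
  \<open>\<tau> powr (real DIM('a) - p)\<close> and a positive finite first term. \<tau> = 2
  describes the behaviour at infinity and \<tau> = 1/2 that at the origin.\<close>

lemma annuli_power_integral_finite_iff:
  fixes s p \<tau> :: real
  assumes "0 < s" "0 \<le> p" "\<tau> = 2 \<or> \<tau> = 1 / 2"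
  shows "(\<integral>\<^sup>+x. ennreal (norm x powr - p) * indicator (\<Union>k. annulus (\<tau> ^ k * s)) (x::'a::euclidean_space) \<partial>lborel) < \<infinity>
    \<longleftrightarrow> \<tau> powr (real DIM('a) - p) < 1"
proof -
  have "0 < \<tau>" using assms by auto
  have disj: "annulus (\<tau> ^ k * s) \<inter> annulus (\<tau> ^ l * s) = ({} :: 'a set)" if "k < l" for k l
  proof (cases "\<tau> = 2")
    case True
    have "(2::real) ^ Suc k \<le> 2 ^ l" using that by (intro power_increasing) auto
    then have "2 * (2 ^ k * s) \<le> 2 ^ l * s" using \<open>0 < s\<close> by simp
    then show ?thesis using True by (auto simp: annulus_def)
  next
    case False
    then have t: "\<tau> = 1 / 2" using assms by simp
    have "(1 / 2 :: real) ^ l \<le> (1 / 2) ^ Suc k" using that by (intro power_decreasing) auto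
    then have "2 * ((1 / 2) ^ l * s) \<le> (1 / 2) ^ k * s" using \<open>0 < s\<close> by simp
    then show ?thesis unfolding t by (auto simp: annulus_def)
  qed
  have "disjoint_family (\<lambda>k. annulus (\<tau> ^ k * s) :: 'a set)"
    unfolding disjoint_family_on_def
  proof (intro ballI impI)
    fix k l :: nat assume "k \<noteq> l"
    then show "annulus (\<tau> ^ k * s) \<inter> annulus (\<tau> ^ l * s) = ({} :: 'a set)"
      using disj[of k l] disj[of l k] by (cases "k < l") auto
  qed
  then have "(\<integral>\<^sup>+x. ennreal (norm x powr - p) * indicator (\<Union>k. annulus (\<tau> ^ k * s)) (x::'a) \<partial>lborel)
      = (\<Sum>k. \<integral>\<^sup>+x. ennreal (norm x powr - p) * indicator (annulus (\<tau> ^ k * s)) (x::'a) \<partial>lborel)"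
    by (intro nn_integral_disjoint_family) auto
  also have "\<dots> = (\<Sum>k. ennreal ((\<tau> powr (real DIM('a) - p)) ^ k) *
      (\<integral>\<^sup>+x. ennreal (norm x powr - p) * indicator (annulus s) (x::'a) \<partial>lborel))"
  proof (intro arg_cong[where f = suminf] ext)
    fix k
    have "(\<tau> ^ k) powr (real DIM('a) - p) = (\<tau> powr (real DIM('a) - p)) ^ k"
      using \<open>0 < \<tau>\<close> by (simp add: powr_realpow[symmetric] powr_powr mult.commute)
    then show "(\<integral>\<^sup>+x. ennreal (norm x powr - p) * indicator (annulus (\<tau> ^ k * s)) (x::'a) \<partial>lborel)
        = ennreal ((\<tau> powr (real DIM('a) - p)) ^ k) *
          (\<integral>\<^sup>+x. ennreal (norm x powr - p) * indicator (annulus s) (x::'a) \<partial>lborel)"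
      using annulus_power_integral_scale[of "\<tau> ^ k" p s, where 'a = 'a] \<open>0 < \<tau>\<close> by simp
  qed
  finally show ?thesis
    using suminf_ennreal_geometric[OF annulus_power_integral[where 'a = 'a, OF assms(1,2)]] by simp
qed

lemma nn_integral_norm_powr_outside_finite_iff:
  fixes s p :: real
  assumes "0 < s" "0 \<le> p"
  shows "(\<integral>\<^sup>+x. ennreal (norm x powr - p) * indicator {x. s \<le> norm x} (x::'a::euclidean_space) \<partial>lborel) < \<infinity>
    \<longleftrightarrow> real DIM('a) < p"
proof -
  have "(\<Union>k. annulus (2 ^ k * s)) = {x::'a. s \<le> norm x}"
  proof safe
    fix x :: 'a and k :: nat assume "x \<in> annulus (2 ^ k * s)"
    then have "1 * s \<le> 2 ^ k * s" "2 ^ k * s \<le> norm x"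
      using \<open>0 < s\<close> by (auto simp: annulus_def)
    then show "s \<le> norm x" by simp
  next
    fix x :: 'a assume x: "s \<le> norm x"
    \<comment> \<open>The shell containing x ends at the first radius \<open>2 ^ n * s\<close> above
      its norm; n is not 0 because \<open>s \<le> norm x\<close>.\<close>
    define n where "n = (LEAST n. norm x < 2 ^ n * s)"
    obtain m where "norm x / s < 2 ^ m" using real_arch_pow[of 2 "norm x / s"] by auto
    then have "norm x < 2 ^ m * s" using \<open>0 < s\<close> by (simp add: field_simps)
    then have n: "norm x < 2 ^ n * s" unfolding n_def by (rule LeastI)
    then obtain k where k: "n = Suc k" using x by (cases n) auto
    then have "\<not> norm x < 2 ^ k * s" unfolding n_def using not_less_Least[of k "\<lambda>n. norm x < 2 ^ n * s"] by simp
    then show "x \<in> (\<Union>k. annulus (2 ^ k * s))"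
      using n k by (auto simp: annulus_def intro!: exI[of _ k])
  qed
  then show ?thesis
    using annuli_power_integral_finite_iff[OF assms, of 2, where 'a = 'a]
      powr_less_cancel_iff[of 2 "real DIM('a) - p" 0] by simp
qed

lemma nn_integral_norm_powr_inside_finite_iff:
  fixes s p :: real
  assumes "0 < s" "0 \<le> p"
  shows "(\<integral>\<^sup>+x. ennreal (norm x powr - p) * indicator {x. norm x < s} (x::'a::euclidean_space) \<partial>lborel) < \<infinity>
    \<longleftrightarrow> p < real DIM('a)"
proof -
  have U: "(\<Union>k. annulus ((1/2) ^ k * (s/2))) = {x::'a. norm x < s} - {0}"
  proof safe
    fix x :: 'a and k :: nat assume "x \<in> annulus ((1/2) ^ k * (s/2))"
    moreover have "(1/2) ^ k * s \<le> 1 * s" using \<open>0 < s\<close> by (intro mult_right_mono power_le_one) auto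
    ultimately show "norm x < s" by (auto simp: annulus_def)
  next
    fix k :: nat assume "(0::'a) \<in> annulus ((1/2) ^ k * (s/2))"
    moreover have "0 < (1/2) ^ k * (s/2)" using \<open>0 < s\<close> by simp
    ultimately show False unfolding annulus_def by simp
  next
    fix x :: 'a assume x: "norm x < s" "x \<notin> (\<Union>k. annulus ((1/2) ^ k * (s/2)))"
    show "x = 0"
    proof (rule ccontr)
      assume "x \<noteq> 0"
      \<comment> \<open>The first inner radius that does not exceed \<open>norm x\<close>. For n = 0
        the outer bound is \<open>norm x < s\<close>, which explains the starting radius
        s/2.\<close>
      define n where "n = (LEAST n. (1/2) ^ n * (s/2) \<le> norm x)"
      obtain m where "(1/2) ^ m < norm x / (s/2)"
        using real_arch_pow_inv[of "norm x / (s/2)" "1/2"] \<open>x \<noteq> 0\<close> \<open>0 < s\<close> by auto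
      then have "(1/2) ^ m * (s/2) \<le> norm x" using \<open>0 < s\<close> by (simp add: field_simps)
      then have n: "(1/2) ^ n * (s/2) \<le> norm x" unfolding n_def by (rule LeastI)
      have "norm x < 2 * ((1/2) ^ n * (s/2))"
      proof (cases n)
        case 0
        then show ?thesis using x by simp
      next
        case (Suc k)
        then have "\<not> (1/2) ^ k * (s/2) \<le> norm x"
          unfolding n_def using not_less_Least[of k "\<lambda>n. (1/2) ^ n * (s/2) \<le> norm x"] by simp
        then show ?thesis using Suc by (simp add: not_le mult.commute)
      qed
      then show False using x(2) n by (auto simp: annulus_def)
    qed
  qed
  \<comment> \<open>The shells miss only the origin, and there \<open>0 powr - p\<close> is 0, so
    both integrands agree.\<close>
  have "(\<integral>\<^sup>+x. ennreal (norm x powr - p) * indicator {x. norm x < s} (x::'a) \<partial>lborel)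
      = (\<integral>\<^sup>+x. ennreal (norm x powr - p) * indicator (\<Union>k. annulus ((1/2) ^ k * (s/2))) (x::'a) \<partial>lborel)"
    unfolding U by (intro nn_integral_cong) (auto simp: indicator_def)
  moreover have "(1/2::real) powr (real DIM('a) - p) < 1 \<longleftrightarrow> p < real DIM('a)"
  proof -
    have "(1/2::real) powr (real DIM('a) - p) = 2 powr (p - real DIM('a))"
      using powr_minus[of 2 "real DIM('a) - p"] by (simp add: powr_divide inverse_eq_divide)
    then show ?thesis using powr_less_cancel_iff[of 2 "p - real DIM('a)" 0] by simp
  qed
  ultimately show ?thesis
    using annuli_power_integral_finite_iff[of "s/2" p "1/2", where 'a = 'a] assms by simp
qed

section \<open>Test functions concentrated in small balls\<close>

section \<open>Smooth bumps\<close>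

text \<open>For n = 0 this is the classical smooth cutoff. The negative powers of t are included
  because differentiation produces them; the family is then closed under differentiation up to
  linear combinations.\<close>

definition bump_profile :: "nat \<Rightarrow> real \<Rightarrow> real" where
  "bump_profile n t = (if 0 < t then exp (- 1 / t) / t ^ n else 0)"

text \<open>A single term of the exponential series, whose terms are nonnegative here.\<close>

lemma power_div_fact_le_exp:
  fixes y :: real
  assumes "0 \<le> y"
  shows "y ^ m / fact m \<le> exp y"
proof -
  have "(\<Sum>k\<in>{m}. y ^ k /\<^sub>R fact k) \<le> (\<Sum>k. y ^ k /\<^sub>R fact k)"
    using assms by (intro sum_le_suminf summable_exp_generic) auto
  then show ?thesis by (simp add: exp_def divide_inverse mult.commute)
qed

lemma bump_profile_nonneg: "0 \<le> bump_profile n t"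
  by (simp add: bump_profile_def)

text \<open>The bound on powers with exponent n + 2 at 1/t leaves two spare powers of t, which makes
  the difference quotient at 0 tend to 0.\<close>

lemma bump_profile_le: "bump_profile n t \<le> fact (n + 2) * t\<^sup>2"
proof (cases "0 < t")
  case True
  define m where "m = n + 2"
  have "(1 / t) ^ m / fact m \<le> exp (1 / t)"
    using True by (intro power_div_fact_le_exp) simp
  then have "(1 / t) ^ m / fact m * (fact m * t ^ m) \<le> exp (1 / t) * (fact m * t ^ m)"
    using True by (intro mult_right_mono) auto
  moreover have "(1 / t) ^ m / fact m * (fact m * t ^ m) = 1"
    using True by (simp add: power_one_over)
  ultimately have "1 \<le> exp (1 / t) * (fact m * t ^ m)" by simp
  then have "exp (- (1 / t)) * 1 \<le> exp (- (1 / t)) * (exp (1 / t) * (fact m * t ^ m))"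
    by (intro mult_left_mono) auto
  also have "\<dots> = fact m * t ^ m"
    by (simp add: mult.assoc[symmetric] exp_add[symmetric])
  finally have "exp (- 1 / t) \<le> fact (n + 2) * t ^ (n + 2)"
    by (simp add: m_def del: fact_Suc power_Suc)
  then have "exp (- 1 / t) / t ^ n \<le> fact (n + 2) * t ^ (n + 2) / t ^ n"
    using True by (intro divide_right_mono) auto
  also have "\<dots> = fact (n + 2) * t\<^sup>2" using True by (simp add: power_add power2_eq_square)
  finally show ?thesis using True by (simp add: bump_profile_def)
qed (simp add: bump_profile_def)

lemma DERIV_bump_profile:
  "(bump_profile n has_real_derivative bump_profile (n + 2) t - real n * bump_profile (n + 1) t) (at t)"
proof -
  consider "t < 0" | "t = 0" | "0 < t" by linarith
  then show ?thesis
  proof cases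
    case 1
    have "((\<lambda>_. 0) has_real_derivative 0) (at t)" by simp
    moreover have "\<forall>\<^sub>F s in nhds t. 0 = bump_profile n s"
      using eventually_nhds_in_open[of "{..<0}" t] 1
      by (auto elim!: eventually_mono simp: bump_profile_def)
    ultimately have "(bump_profile n has_real_derivative 0) (at t)"
      by (subst DERIV_cong_ev[OF refl _ refl, of _ "\<lambda>_. 0"]) (auto elim: eventually_mono)
    then show ?thesis using 1 by (simp add: bump_profile_def)
  next
    case 2
    have "(\<lambda>h. bump_profile n h / h) \<midarrow>0\<rightarrow> 0"
    proof (rule Lim_null_comparison)
      show "\<forall>\<^sub>F h in at 0. norm (bump_profile n h / h) \<le> fact (n + 2) * \<bar>h\<bar>"
      proof (rule always_eventually, rule allI)
        fix h :: real
        have "bump_profile n h / \<bar>h\<bar> \<le> fact (n + 2) * h\<^sup>2 / \<bar>h\<bar>"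
          by (intro divide_right_mono bump_profile_le) simp
        also have "\<dots> = fact (n + 2) * \<bar>h\<bar>"
          by (cases "h = 0") (simp_all add: power2_eq_square abs_if)
        finally show "norm (bump_profile n h / h) \<le> fact (n + 2) * \<bar>h\<bar>"
          using bump_profile_nonneg[of n h] by (simp add: abs_divide)
      qed
      have "(\<lambda>h::real. fact (n + 2) * \<bar>h\<bar>) \<midarrow>0\<rightarrow> fact (n + 2) * \<bar>0\<bar>"
        by (intro tendsto_intros)
      then show "(\<lambda>h::real. fact (n + 2) * \<bar>h\<bar>) \<midarrow>0\<rightarrow> 0" by simp
    qed
    then have "(bump_profile n has_real_derivative 0) (at 0)"
      by (simp add: DERIV_def bump_profile_def)
    then show ?thesis using 2 by (simp add: bump_profile_def)
  next
    case 3
    have eq: "bump_profile m s = exp (- inverse s) * inverse s ^ m" if "0 < s" for m s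
      using that by (simp add: bump_profile_def divide_inverse power_inverse)
    \<comment> \<open>For n = 0 the exponent \<open>n - 1\<close> truncates to 0, but the factor
      \<open>real n\<close> removes the term.\<close>
    have "((\<lambda>t. exp (- inverse t) * inverse t ^ n) has_real_derivative
        exp (- inverse t) * (real n * inverse t ^ (n - 1) * (- ((inverse t)\<^sup>2)))
        + exp (- inverse t) * (inverse t)\<^sup>2 * inverse t ^ n) (at t)"
      using 3 by (auto intro!: derivative_eq_intros simp: power2_eq_square)
    moreover have "exp (- inverse t) * (real n * inverse t ^ (n - 1) * (- ((inverse t)\<^sup>2)))
        + exp (- inverse t) * (inverse t)\<^sup>2 * inverse t ^ n
        = bump_profile (n + 2) t - real n * bump_profile (n + 1) t"
      unfolding eq[OF 3] by (cases n) (simp_all add: power2_eq_square)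
    ultimately have "((\<lambda>t. exp (- inverse t) * inverse t ^ n) has_real_derivative
        bump_profile (n + 2) t - real n * bump_profile (n + 1) t) (at t)"
      by simp
    moreover have ev: "\<forall>\<^sub>F s in nhds t. exp (- inverse s) * inverse s ^ n = bump_profile n s"
      using eventually_nhds_in_open[of "{0<..}" t] 3
      by (auto elim!: eventually_mono simp: eq)
    ultimately show ?thesis
      using DERIV_cong_ev[OF refl ev refl] by simp
  qed
qed

text \<open>A set of functions closed under partial derivatives: the chain rule applied to a profile
  produces higher profiles and a coordinate factor. Smoothness of all orders then needs only one
  differentiation step.\<close>

inductive_set bump_span :: "real^'d \<Rightarrow> real \<Rightarrow> (real^'d \<Rightarrow> real) set"
  for x :: "real^'d" and r :: real where
  profile: "(\<lambda>y. bump_profile n (r\<^sup>2 - (y - x) \<bullet> (y - x))) \<in> bump_span x r"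
| coord: "f \<in> bump_span x r \<Longrightarrow> (\<lambda>y. ((y - x) \<bullet> axis i 1) * f y) \<in> bump_span x r"
| scale: "f \<in> bump_span x r \<Longrightarrow> (\<lambda>y. c * f y) \<in> bump_span x r"
| add: "f \<in> bump_span x r \<Longrightarrow> g \<in> bump_span x r \<Longrightarrow> (\<lambda>y. f y + g y) \<in> bump_span x r"

lemma bump_span_zero_outside:
  assumes "f \<in> bump_span x r" "0 \<le> r" "r \<le> norm (y - x)"
  shows "f y = 0"
  using assms(1)
proof induction
  case (profile n)
  have "r\<^sup>2 \<le> (norm (y - x))\<^sup>2" using assms by (intro power_mono) auto
  then show ?case by (simp add: bump_profile_def power2_norm_eq_inner)
qed auto

text \<open>The derivative and the membership of its partial derivatives are carried together
  through the induction, since the product rule for a coordinate factor needs both.\<close>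

lemma bump_span_has_derivative:
  assumes "f \<in> bump_span x r"
  shows "\<exists>f'. (\<forall>y. (f has_derivative f' y) (at y)) \<and> (\<forall>i. (\<lambda>y. f' y (axis i 1)) \<in> bump_span x r)"
  using assms
proof induction
  case (profile n)
  define q where "q y = r\<^sup>2 - (y - x) \<bullet> (y - x)" for y
  define f' where "f' y h = (bump_profile (n + 2) (q y) - real n * bump_profile (n + 1) (q y))
    * (- 2 * ((y - x) \<bullet> h))" for y h
  have "((\<lambda>y. bump_profile n (q y)) has_derivative f' y) (at y)" for y
  proof -
    have q: "(q has_derivative (\<lambda>h. - 2 * ((y - x) \<bullet> h))) (at y)"
      unfolding q_def[abs_def] by (auto intro!: derivative_eq_intros simp: inner_commute)
    have "(bump_profile n has_derivative
        (*) (bump_profile (n + 2) (q y) - real n * bump_profile (n + 1) (q y))) (at (q y))"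
      using DERIV_bump_profile[of n "q y"] by (simp add: has_field_derivative_def)
    from has_derivative_compose[OF q this] show ?thesis
      by (simp add: f'_def[abs_def])
  qed
  moreover have "(\<lambda>y. f' y (axis i 1)) \<in> bump_span x r" for i
  proof -
    have "(\<lambda>y. - 2 * (((y - x) \<bullet> axis i 1) * (bump_profile (n + 2) (q y)
          + (- real n) * bump_profile (n + 1) (q y)))) \<in> bump_span x r"
      unfolding q_def by (intro bump_span.intros)
    then show ?thesis by (simp add: f'_def algebra_simps)
  qed
  ultimately show ?case unfolding q_def by blast
next
  case (coord f i)
  then obtain f' where f': "\<And>y. (f has_derivative f' y) (at y)"
      "\<And>j. (\<lambda>y. f' y (axis j 1)) \<in> bump_span x r" by blast
  have "((\<lambda>y. ((y - x) \<bullet> axis i 1) * f y) has_derivative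
      (\<lambda>h. ((y - x) \<bullet> axis i 1) * f' y h + (h \<bullet> axis i 1) * f y)) (at y)" for y
    by (auto intro!: derivative_eq_intros f'(1))
  moreover have "(\<lambda>y. ((y - x) \<bullet> axis i 1) * f' y (axis j 1) + (axis j 1 \<bullet> axis i 1) * f y) \<in> bump_span x r" for j
    by (intro bump_span.intros f'(2) coord)
  ultimately show ?case by (intro exI[of _ "\<lambda>y h. ((y - x) \<bullet> axis i 1) * f' y h + (h \<bullet> axis i 1) * f y"]) auto
next
  case (scale f c)
  then obtain f' where f': "\<And>y. (f has_derivative f' y) (at y)"
      "\<And>j. (\<lambda>y. f' y (axis j 1)) \<in> bump_span x r" by blast
  then show ?case
    by (intro exI[of _ "\<lambda>y h. c * f' y h"]) (auto intro!: derivative_eq_intros bump_span.intros)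
next
  case (add f g)
  then obtain f' g' where f': "\<And>y. (f has_derivative f' y) (at y)"
      "\<And>j. (\<lambda>y. f' y (axis j 1)) \<in> bump_span x r"
      and g': "\<And>y. (g has_derivative g' y) (at y)"
      "\<And>j. (\<lambda>y. g' y (axis j 1)) \<in> bump_span x r" by blast
  then show ?case
    by (intro exI[of _ "\<lambda>y h. f' y h + g' y h"]) (auto intro!: derivative_eq_intros bump_span.intros)
qed

lemma bump_span_continuous:
  assumes "f \<in> bump_span x r" shows "continuous_on UNIV f"
  using bump_span_has_derivative[OF assms] has_derivative_continuous
  by (meson continuous_at_imp_continuous_on)

lemma bump_span_Ck: "f \<in> bump_span x r \<Longrightarrow> Ck k f"
proof (induction k arbitrary: f)
  case 0
  then show ?case by (simp add: bump_span_continuous)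
next
  case (Suc k)
  obtain f' where f': "\<And>y. (f has_derivative f' y) (at y)"
      "\<And>j. (\<lambda>y. f' y (axis j 1)) \<in> bump_span x r"
    using bump_span_has_derivative[OF Suc.prems] by blast
  \<comment> \<open>Uniqueness of the derivative identifies the chosen
    \<open>frechet_derivative\<close> with \<open>f'\<close>.\<close>
  have "partial_deriv i f = (\<lambda>y. f' y (axis i 1))" for i
    unfolding partial_deriv_def using frechet_derivative_at[OF f'(1)] by (intro ext) metis
  then show ?case using f' Suc.IH by (auto simp: differentiable_def)
qed

lemma bump_span_test_function:
  assumes "f \<in> bump_span x r" "0 \<le> r"
  shows "f \<in> test_functions"
proof -
  have "{y. f y \<noteq> 0} \<subseteq> cball x r"
    using bump_span_zero_outside[OF assms] by (force simp: dist_norm norm_minus_commute)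
  then have "bounded {y. f y \<noteq> 0}" by (rule bounded_subset[OF bounded_cball])
  then show ?thesis
    using bump_span_Ck[OF assms(1)] by (simp add: test_functions_def compact_closure)
qed

text \<open>The type argument records the dimension, which r alone does not determine.\<close>

definition bump_mass :: "real \<Rightarrow> 'd::finite itself \<Rightarrow> real" where
  "bump_mass r _ = (\<integral>y. bump_profile 0 (r\<^sup>2 - y \<bullet> y) \<partial>(lborel :: (real^'d) measure))"

definition bump :: "real^'d \<Rightarrow> real \<Rightarrow> real^'d \<Rightarrow> real" where
  "bump x r y = bump_profile 0 (r\<^sup>2 - (y - x) \<bullet> (y - x)) / bump_mass r TYPE('d)"

lemma bump_in_bump_span: "bump x r \<in> bump_span x r"
  using bump_span.scale[OF bump_span.profile[of 0 r x], of "1 / bump_mass r TYPE('a)"]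
  unfolding bump_def by simp

text \<open>The symmetry between centre and argument lets Tonelli's theorem integrate over the
  centre later.\<close>

lemma bump_commute: "bump x r y = bump y r x"
proof -
  have "(y - x) \<bullet> (y - x) = (x - y) \<bullet> (x - y)"
    by (simp add: inner_diff inner_commute)
  then show ?thesis by (simp add: bump_def)
qed

lemma bump_profile_measurable [measurable]: "bump_profile n \<in> borel_measurable borel"
  unfolding bump_profile_def[abs_def] by measurable

lemma bump_measurable [measurable (raw)]:
  assumes [measurable]: "f \<in> borel_measurable N" "g \<in> borel_measurable N"
  shows "(\<lambda>w. bump (f w) r (g w)) \<in> borel_measurable N"
  unfolding bump_def by measurable

text \<open>A continuous function that vanishes off a closed ball is integrable. Mass 0 would make
  the profile vanish almost everywhere, but it is positive on the open ball.\<close>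

lemma bump_mass_pos:
  assumes "0 < r"
  shows "integrable lborel (\<lambda>y::real^'d. bump_profile 0 (r\<^sup>2 - y \<bullet> y))"
    and "0 < bump_mass r TYPE('d::finite)"
proof -
  let ?f = "\<lambda>y::real^'d. bump_profile 0 (r\<^sup>2 - y \<bullet> y)"
  have mem: "?f \<in> bump_span 0 r" using bump_span.profile[of 0 r 0] by simp
  have "integrable lborel (\<lambda>y. indicator (cball 0 r) y *\<^sub>R ?f y)"
    by (intro borel_integrable_compact continuous_on_subset[OF bump_span_continuous[OF mem]]) auto
  moreover have "(\<lambda>y. indicator (cball 0 r) y *\<^sub>R ?f y) = ?f"
    using bump_span_zero_outside[OF mem] assms by (intro ext) (auto simp: indicator_def)
  ultimately show int: "integrable lborel ?f" by metis
  show "0 < bump_mass r TYPE('d)"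
  proof (rule ccontr)
    assume "\<not> 0 < bump_mass r TYPE('d)"
    moreover have "0 \<le> (\<integral>y. ?f y \<partial>lborel)"
      by (rule Bochner_Integration.integral_nonneg) (rule bump_profile_nonneg)
    ultimately have "(\<integral>y. ?f y \<partial>lborel) = 0"
      unfolding bump_mass_def by linarith
    then have "AE y in lborel. ?f y = 0"
      using integral_nonneg_eq_0_iff_AE[OF int] bump_profile_nonneg by auto
    moreover have "?f y \<noteq> 0" if "y \<in> ball 0 r" for y
    proof -
      have "(norm y)\<^sup>2 < r\<^sup>2" using that by (intro power_strict_mono) auto
      then show ?thesis by (simp add: bump_profile_def power2_norm_eq_inner)
    qed
    ultimately have "AE y in lborel. y \<notin> ball (0::real^'d) r" by (auto elim!: eventually_mono)
    then have "emeasure lborel (ball (0::real^'d) r) = 0"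
      by (subst (asm) AE_iff_measurable[of "ball 0 r"]) auto
    then show False using content_ball_pos[OF assms, of "0::real^'d"] by (simp add: measure_def)
  qed
qed

lemma bump_nonneg: "0 < r \<Longrightarrow> 0 \<le> bump x r y"
  unfolding bump_def by (intro divide_nonneg_pos bump_profile_nonneg bump_mass_pos(2))

lemma bump_eq_0: "0 < r \<Longrightarrow> r \<le> norm (y - x) \<Longrightarrow> bump x r y = 0"
  by (rule bump_span_zero_outside[OF bump_in_bump_span]) auto

lemma bump_nn_integral:
  assumes "0 < r"
  shows "(\<integral>\<^sup>+y. ennreal (bump x r y) \<partial>lborel) = 1"
proof -
  have "(\<integral>\<^sup>+y. ennreal (bump x r y) \<partial>lborel) = (\<integral>\<^sup>+y. ennreal (bump 0 r (y - x)) \<partial>lborel)"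
    by (simp add: bump_def)
  also have "\<dots> = (\<integral>\<^sup>+y. ennreal (bump (0::real^'a) r y) \<partial>lborel)"
    by (rule nn_integral_translate) measurable
  also have "\<dots> = ennreal (\<integral>y. bump (0::real^'a) r y \<partial>lborel)"
  proof (rule nn_integral_eq_integral)
    show "integrable lborel (bump (0::real^'a) r)"
      using bump_mass_pos(1)[OF assms, where 'd = 'a] by (simp add: bump_def[abs_def])
  qed (simp add: bump_nonneg[OF assms])
  also have "(\<integral>y. bump (0::real^'a) r y \<partial>lborel) = 1"
    using bump_mass_pos(2)[OF assms, where 'd = 'a] by (simp add: bump_def bump_mass_def)
  finally show ?thesis by simp
qed

lemma bump_integral:
  assumes "0 < r"
  shows "integrable lborel (bump x r)" "(\<integral>y. bump x r y \<partial>lborel) = 1"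
proof -
  show int: "integrable lborel (bump x r)"
  proof (rule integrableI_nonneg)
    show "(\<integral>\<^sup>+y. ennreal (bump x r y) \<partial>lborel) < \<infinity>"
      unfolding bump_nn_integral[OF assms] by simp
  qed (simp_all add: bump_nonneg[OF assms])
  have "ennreal (\<integral>y. bump x r y \<partial>lborel) = ennreal 1"
    using nn_integral_eq_integral[OF int] bump_nonneg[OF assms, of x]
    unfolding bump_nn_integral[OF assms] by simp
  moreover have "0 \<le> (\<integral>y. bump x r y \<partial>lborel)"
    by (rule Bochner_Integration.integral_nonneg) (rule bump_nonneg[OF assms])
  ultimately show "(\<integral>y. bump x r y \<partial>lborel) = 1" by (simp only: ennreal_inj)
qed

section \<open>Lower and upper bounds for the potentials of test functions\<close>

section \<open>Convolution with the fundamental solution\<close>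

lemma rho_P_measurable [measurable]: "rho_P \<in> borel_measurable (borel :: (real^'d) measure)"
  unfolding rho_P_def[abs_def] Let_def by measurable

lemma conv_rho_P_measurable [measurable]:
  fixes \<phi> :: "real^'d \<Rightarrow> real"
  assumes [measurable]: "\<phi> \<in> borel_measurable borel"
  shows "conv_rho_P \<phi> \<in> borel_measurable borel"
  unfolding conv_rho_P_def[abs_def] by measurable

lemma rho_P_eq_powr:
  assumes "3 \<le> CARD('d::finite)"
  shows "\<exists>K>0. \<forall>z::real^'d. rho_P z = K * norm z powr - real (CARD('d) - 2)"
proof -
  let ?d = "CARD('d)"
  define K where "K = 1 / (2 * pi powr (real ?d / 2) * (real ?d - 2) / Gamma (real ?d / 2))"
  have "0 < Gamma (real ?d / 2)" using assms by (intro Gamma_real_pos) simp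
  then have "K > 0" using assms by (simp add: K_def)
  moreover have "rho_P z = K * norm z powr - real (?d - 2)" for z :: "real^'d"
  proof -
    \<comment> \<open>Both sides are 0 at the origin by the conventions for \<open>powr\<close> and
      division.\<close>
    have powr: "norm z powr - real m = 1 / norm z ^ m" if "0 < m" for m
      using that by (cases "z = 0") (simp_all add: powr_minus powr_realpow inverse_eq_divide)
    have "rho_P z = K * (1 / norm z ^ (?d - 2))"
      using assms unfolding rho_P_def Let_def K_def by simp
    then show ?thesis using powr[of "?d - 2"] assms by simp
  qed
  ultimately show ?thesis by blast
qed

text \<open>The sign \<sigma> is that of the fundamental solution: 1 for d \<ge> 3, and -1 in
  dimensions 1 and 2 at distance at least 3 from the origin, where the exponent truncates to 0 and
  the lower bound is a positive constant.\<close>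

lemma rho_P_lower_bound:
  "\<exists>k>0. \<exists>\<sigma>\<in>{-1, 1}. \<forall>z::real^'d. 3 \<le> CARD('d) \<or> 3 \<le> norm z \<longrightarrow>
     k * norm z powr - real (CARD('d) - 2) \<le> \<sigma> * rho_P z"
proof -
  consider "CARD('d) = 1" | "CARD('d) = 2" | "3 \<le> CARD('d)"
    using zero_less_card_finite[where 'a = 'd] by linarith
  then show ?thesis
  proof cases
    case 1
    \<comment> \<open>In dimension 1, \<open>- rho_P z\<close> is \<open>norm z / 2\<close>, hence
      at least 3/2 in the relevant range.\<close>
    then show ?thesis by (intro exI[of _ 1] conjI bexI[of _ "-1"]) (auto simp: rho_P_def)
  next
    case 2
    have "ln 3 / (2 * pi) \<le> - 1 * rho_P z" if "3 \<le> norm z" for z :: "real^'d"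
    proof -
      have "ln 3 \<le> ln (norm z)" using that by (intro ln_mono) auto
      then have "1 / (2 * pi) * ln 3 \<le> 1 / (2 * pi) * ln (norm z)"
        by (intro mult_left_mono) auto
      moreover have "z \<noteq> 0" using that by auto
      ultimately show ?thesis using 2 by (simp add: rho_P_def ln_div)
    qed
    moreover have "norm z powr - real (CARD('d) - 2) \<le> 1" for z :: "real^'d"
      using 2 by simp
    ultimately show ?thesis
      using 2 by (intro exI[of _ "ln 3 / (2 * pi)"] conjI bexI[of _ "-1"]) (auto simp: divide_simps)
  next
    case 3
    then obtain K where "K > 0" "\<And>z::real^'d. rho_P z = K * norm z powr - real (CARD('d) - 2)"
      using rho_P_eq_powr by blast
    then show ?thesis by (intro exI[of _ K] conjI bexI[of _ 1]) auto
  qed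
qed

lemma continuous_on_rho_P: "continuous_on (- {0}) (rho_P :: real^'d \<Rightarrow> real)"
  unfolding rho_P_def[abs_def] Let_def
  by (cases "CARD('d) = 1"; cases "CARD('d) = 2") (auto intro!: continuous_intros)

text \<open>The bump is a probability density, so it averages values that are at least \<kappa> to
  at least \<kappa>. As y lies outside its support, the integrand is continuous on a compact ball
  and so integrable; otherwise the Bochner integral would default to 0.\<close>

lemma abs_conv_rho_P_bump_ge:
  fixes x y :: "real^'d"
  assumes "0 < r" "\<sigma> \<in> {-1, 1}" "r < norm (y - x)"
    and ge: "\<And>z. z \<in> cball x r \<Longrightarrow> \<kappa> \<le> \<sigma> * rho_P (z - y)"
  shows "\<kappa> \<le> \<bar>conv_rho_P (bump x r) y\<bar>"
proof -
  have supp: "bump x r z = 0" if "z \<notin> cball x r" for z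
    using that by (intro bump_eq_0[OF \<open>0 < r\<close>]) (simp add: dist_norm norm_minus_commute)
  have "y \<notin> cball x r" using assms(3) by (simp add: dist_norm norm_minus_commute)
  then have "continuous_on (cball x r) (\<lambda>z. rho_P (z - y))"
    by (intro continuous_on_compose2[OF continuous_on_rho_P] continuous_intros) auto
  moreover have "continuous_on (cball x r) (bump x r)"
    by (rule continuous_on_subset[OF bump_span_continuous[OF bump_in_bump_span]]) auto
  ultimately have "integrable lborel (\<lambda>z. indicator (cball x r) z *\<^sub>R (rho_P (z - y) * bump x r z))"
    by (intro borel_integrable_compact continuous_intros) auto
  moreover have "(\<lambda>z. indicator (cball x r) z *\<^sub>R (rho_P (z - y) * bump x r z)) = (\<lambda>z. rho_P (z - y) * bump x r z)"
    using supp by (intro ext) (auto simp: indicator_def)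
  ultimately have int: "integrable lborel (\<lambda>z. rho_P (z - y) * bump x r z)" by metis
  have "\<kappa> = (\<integral>z. \<kappa> * bump x r z \<partial>lborel)"
    using bump_integral[OF \<open>0 < r\<close>, of x] by simp
  also have "\<dots> \<le> (\<integral>z. \<sigma> * (rho_P (z - y) * bump x r z) \<partial>lborel)"
  proof (rule integral_mono)
    fix z
    show "\<kappa> * bump x r z \<le> \<sigma> * (rho_P (z - y) * bump x r z)"
    proof (cases "z \<in> cball x r")
      case True
      then show ?thesis
        using mult_right_mono[OF ge[OF True] bump_nonneg[OF \<open>0 < r\<close>]] by (simp add: mult.assoc)
    qed (simp add: supp)
  qed (use int bump_integral[OF \<open>0 < r\<close>, of x] in auto)
  also have "\<dots> = \<sigma> * conv_rho_P (bump x r) y"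
    using int by (simp add: conv_rho_P_def)
  also have "\<dots> \<le> \<bar>conv_rho_P (bump x r) y\<bar>" using assms(2) by auto
  finally show ?thesis .
qed

text \<open>In dimensions 1 and 2 the bound is only claimed far from the origin, where the fundamental
  solution has constant sign and is bounded away from 0; there the exponent
  \<^term>\<open>CARD('d) - 2\<close> is 0 (truncated subtraction).\<close>

lemma conv_rho_P_bump_lower_bound:
  "\<exists>k>0. \<forall>(x::real^'d) r s y. 0 < r \<longrightarrow> 2 * r \<le> s \<longrightarrow> 3 \<le> CARD('d) \<or> (r \<le> 1 \<and> 4 \<le> s) \<longrightarrow>
     s \<le> norm (y - x) \<longrightarrow>
     k * norm (y - x) powr - real (CARD('d) - 2) \<le> \<bar>conv_rho_P (bump x r) y\<bar>"
proof -
  let ?m = "real (CARD('d) - 2)"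
  obtain k \<sigma> where k: "k > 0" "\<sigma> \<in> {-1, 1}" and ge: "\<And>z::real^'d. 3 \<le> CARD('d) \<or> 3 \<le> norm z \<Longrightarrow>
     k * norm z powr - ?m \<le> \<sigma> * rho_P z"
    using rho_P_lower_bound by blast
  \<comment> \<open>For z in the ball, \<open>norm (z - y)\<close> is at most
    \<open>2 * norm (y - x)\<close>, whence the factor \<open>2 powr - ?m\<close>; if r \<le> 1 and
    s \<ge> 4 it is at least 3, as the bound on \<open>rho_P\<close> requires in low
    dimension.\<close>
  have "k * 2 powr - ?m * norm (y - x) powr - ?m \<le> \<bar>conv_rho_P (bump x r) y\<bar>"
    if r: "0 < r" "2 * r \<le> s" "3 \<le> CARD('d) \<or> (r \<le> 1 \<and> 4 \<le> s)" and y: "s \<le> norm (y - x)"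
    for x y :: "real^'d" and r s
  proof (rule abs_conv_rho_P_bump_ge[OF r(1) k(2)])
    show "r < norm (y - x)" using r y by linarith
    fix z assume "z \<in> cball x r"
    then have z: "norm (z - x) \<le> r" by (simp add: dist_norm norm_minus_commute)
    have "norm (z - y) \<le> norm (z - x) + norm (y - x)"
      using norm_triangle_ineq4[of "z - x" "y - x"] by simp
    then have le: "norm (z - y) \<le> 2 * norm (y - x)" using r y z by linarith
    have "norm (y - x) - norm (z - x) \<le> norm (z - y)"
      using norm_triangle_ineq2[of "y - x" "z - x"] by (simp add: norm_minus_commute)
    then have "0 < norm (z - y)" "r \<le> 1 \<and> 4 \<le> s \<longrightarrow> 3 \<le> norm (z - y)"
      using r y z by linarith+
    then have "k * norm (z - y) powr - ?m \<le> \<sigma> * rho_P (z - y)"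
      using r by (intro ge) auto
    moreover have "(2 * norm (y - x)) powr - ?m \<le> norm (z - y) powr - ?m"
      using le \<open>0 < norm (z - y)\<close> by (intro powr_mono2') auto
    then have "k * (2 * norm (y - x)) powr - ?m \<le> k * norm (z - y) powr - ?m"
      using k by (intro mult_left_mono) auto
    ultimately show "k * 2 powr - ?m * norm (y - x) powr - ?m \<le> \<sigma> * rho_P (z - y)"
      by (simp add: powr_mult mult.assoc)
  qed
  then show ?thesis using k(1) by (intro exI[of _ "k * 2 powr - ?m"]) auto
qed

text \<open>The pointwise bound is raised to the power \<alpha> and translated to the origin. The
  constant depends on none of x, r and s, which is what letting r tend to 0 needs.\<close>

lemma conv_rho_P_bump_integral_ge:
  assumes "0 < \<alpha>"
  shows "\<exists>k>0. \<forall>(x::real^'d) r s. 0 < r \<longrightarrow> 2 * r \<le> s \<longrightarrow> 3 \<le> CARD('d) \<or> (r \<le> 1 \<and> 4 \<le> s) \<longrightarrow>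
     ennreal k * (\<integral>\<^sup>+y. ennreal (norm y powr - (real (CARD('d) - 2) * \<alpha>)) * indicator {y. s \<le> norm y} (y::real^'d) \<partial>lborel)
       \<le> (\<integral>\<^sup>+y. ennreal (\<bar>conv_rho_P (bump x r) y\<bar> powr \<alpha>) \<partial>lborel)"
proof -
  let ?m = "real (CARD('d) - 2)"
  obtain k where "k > 0" and k: "\<And>(x::real^'d) r s y. 0 < r \<Longrightarrow> 2 * r \<le> s \<Longrightarrow>
      3 \<le> CARD('d) \<or> (r \<le> 1 \<and> 4 \<le> s) \<Longrightarrow> s \<le> norm (y - x) \<Longrightarrow>
     k * norm (y - x) powr - ?m \<le> \<bar>conv_rho_P (bump x r) y\<bar>"
    using conv_rho_P_bump_lower_bound by blast
  have "ennreal (k powr \<alpha>) * (\<integral>\<^sup>+y. ennreal (norm y powr - (?m * \<alpha>)) * indicator {y. s \<le> norm y} (y::real^'d) \<partial>lborel)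
       \<le> (\<integral>\<^sup>+y. ennreal (\<bar>conv_rho_P (bump x r) y\<bar> powr \<alpha>) \<partial>lborel)"
    if r: "0 < r" "2 * r \<le> s" "3 \<le> CARD('d) \<or> (r \<le> 1 \<and> 4 \<le> s)" for x :: "real^'d" and r s
  proof -
    let ?h = "\<lambda>y. ennreal (k powr \<alpha>) * (ennreal (norm y powr - (?m * \<alpha>)) * indicator {y. s \<le> norm y} (y::real^'d))"
    have "ennreal (k powr \<alpha>) * (\<integral>\<^sup>+y. ennreal (norm y powr - (?m * \<alpha>)) * indicator {y. s \<le> norm y} (y::real^'d) \<partial>lborel)
        = (\<integral>\<^sup>+y. ?h y \<partial>lborel)"
      by (subst nn_integral_cmult) auto
    also have "\<dots> = (\<integral>\<^sup>+y. ?h (y - x) \<partial>lborel)"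
      by (rule nn_integral_translate[symmetric]) measurable
    also have "\<dots> \<le> (\<integral>\<^sup>+y. ennreal (\<bar>conv_rho_P (bump x r) y\<bar> powr \<alpha>) \<partial>lborel)"
    proof (rule nn_integral_mono)
      fix y
      show "?h (y - x) \<le> ennreal (\<bar>conv_rho_P (bump x r) y\<bar> powr \<alpha>)"
      proof (cases "s \<le> norm (y - x)")
        case True
        have "(k * norm (y - x) powr - ?m) powr \<alpha> \<le> \<bar>conv_rho_P (bump x r) y\<bar> powr \<alpha>"
          using k[OF r True] \<open>k > 0\<close> \<open>0 < \<alpha>\<close> by (intro powr_mono2) auto
        then show ?thesis
          using True \<open>k > 0\<close> by (simp add: powr_mult powr_powr ennreal_mult'[symmetric] ennreal_leI)
      qed simp
    qed
    finally show ?thesis .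
  qed
  then show ?thesis using \<open>k > 0\<close> by (intro exI[of _ "k powr \<alpha>"]) auto
qed

text \<open>For exponents above d the singularity at the origin is too strong, otherwise the tail
  decays too slowly; in dimensions 1 and 2 only the tail is used.\<close>

lemma rho_P_not_Lp:
  assumes "0 < \<alpha>"
  shows "(\<integral>\<^sup>+y. ennreal (\<bar>rho_P (0 - y :: real^'d)\<bar> powr \<alpha>) \<partial>lborel) = \<infinity>"
proof -
  let ?m = "real (CARD('d) - 2)"
  obtain k \<sigma> where "k > 0" "\<sigma> \<in> {-1, 1}" and ge: "\<And>z::real^'d. 3 \<le> CARD('d) \<or> 3 \<le> norm z \<Longrightarrow>
     k * norm z powr - ?m \<le> \<sigma> * rho_P z"
    using rho_P_lower_bound by blast
  have le: "ennreal (k powr \<alpha>) * (\<integral>\<^sup>+y. ennreal (norm y powr - (?m * \<alpha>)) * indicator A y \<partial>lborel)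
      \<le> (\<integral>\<^sup>+y. ennreal (\<bar>rho_P (0 - y :: real^'d)\<bar> powr \<alpha>) \<partial>lborel)"
    if A[measurable]: "A \<in> sets borel" "\<And>y. y \<in> A \<Longrightarrow> 3 \<le> CARD('d) \<or> 3 \<le> norm y" for A :: "(real^'d) set"
  proof -
    have "ennreal (k powr \<alpha>) * (\<integral>\<^sup>+y. ennreal (norm y powr - (?m * \<alpha>)) * indicator A y \<partial>lborel)
        = (\<integral>\<^sup>+y. ennreal (k powr \<alpha>) * (ennreal (norm y powr - (?m * \<alpha>)) * indicator A y) \<partial>lborel)"
      by (subst nn_integral_cmult) auto
    also have "\<dots> \<le> (\<integral>\<^sup>+y. ennreal (\<bar>rho_P (0 - y :: real^'d)\<bar> powr \<alpha>) \<partial>lborel)"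
    proof (rule nn_integral_mono)
      fix y :: "real^'d"
      show "ennreal (k powr \<alpha>) * (ennreal (norm y powr - (?m * \<alpha>)) * indicator A y)
          \<le> ennreal (\<bar>rho_P (0 - y)\<bar> powr \<alpha>)"
      proof (cases "y \<in> A")
        case True
        have "k * norm y powr - ?m \<le> \<sigma> * rho_P (0 - y)"
          using ge[of "0 - y"] A(2)[OF True] by simp
        also have "\<dots> \<le> \<bar>rho_P (0 - y)\<bar>" using \<open>\<sigma> \<in> {-1, 1}\<close> by auto
        finally have "(k * norm y powr - ?m) powr \<alpha> \<le> \<bar>rho_P (0 - y)\<bar> powr \<alpha>"
          using \<open>k > 0\<close> \<open>0 < \<alpha>\<close> by (intro powr_mono2) auto
        then show ?thesis
          using True \<open>k > 0\<close> by (simp add: powr_mult powr_powr ennreal_mult'[symmetric] ennreal_leI)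
      qed simp
    qed
    finally show ?thesis .
  qed
  show ?thesis
  proof (cases "real CARD('d) < ?m * \<alpha>")
    case True
    then have "3 \<le> CARD('d)" by (cases "CARD('d) \<le> 2") auto
    have "\<not> (\<integral>\<^sup>+y. ennreal (norm y powr - (?m * \<alpha>)) * indicator {y. norm y < 1} (y::real^'d) \<partial>lborel) < \<infinity>"
      using True \<open>0 < \<alpha>\<close> by (subst nn_integral_norm_powr_inside_finite_iff) (auto simp del: of_nat_diff)
    then have "ennreal (k powr \<alpha>) * (\<integral>\<^sup>+y. ennreal (norm y powr - (?m * \<alpha>)) * indicator {y. norm y < 1} (y::real^'d) \<partial>lborel) = \<infinity>"
      using \<open>k > 0\<close> by (simp add: ennreal_mult_eq_top_iff not_less top_unique)
    then show ?thesis using le[of "{y. norm y < 1}"] \<open>3 \<le> CARD('d)\<close> by (simp add: top_unique)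
  next
    case False
    have "\<not> (\<integral>\<^sup>+y. ennreal (norm y powr - (?m * \<alpha>)) * indicator {y. 3 \<le> norm y} (y::real^'d) \<partial>lborel) < \<infinity>"
      using False \<open>0 < \<alpha>\<close> by (subst nn_integral_norm_powr_outside_finite_iff) auto
    then have "ennreal (k powr \<alpha>) * (\<integral>\<^sup>+y. ennreal (norm y powr - (?m * \<alpha>)) * indicator {y. 3 \<le> norm y} (y::real^'d) \<partial>lborel) = \<infinity>"
      using \<open>k > 0\<close> by (simp add: ennreal_mult_eq_top_iff not_less top_unique)
    then show ?thesis using le[of "{y. 3 \<le> norm y}"] by (simp add: top_unique)
  qed
qed

text \<open>Radius 1 and distance 4 satisfy the side conditions in every dimension, and beyond that
  distance the tail is not integrable.\<close>

lemma conv_rho_P_bump_not_Lp: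
  assumes "0 < \<alpha>" "real (CARD('d) - 2) * \<alpha> \<le> real CARD('d)"
  shows "(\<integral>\<^sup>+y. ennreal (\<bar>conv_rho_P (bump (0::real^'d) 1) y\<bar> powr \<alpha>) \<partial>lborel) = \<infinity>"
proof -
  obtain k where "k > 0" and k:
     "ennreal k * (\<integral>\<^sup>+y. ennreal (norm y powr - (real (CARD('d) - 2) * \<alpha>)) * indicator {y. 4 \<le> norm y} (y::real^'d) \<partial>lborel)
       \<le> (\<integral>\<^sup>+y. ennreal (\<bar>conv_rho_P (bump (0::real^'d) 1) y\<bar> powr \<alpha>) \<partial>lborel)"
    using conv_rho_P_bump_integral_ge[OF assms(1), where 'd = 'd] by force
  have "\<not> (\<integral>\<^sup>+y. ennreal (norm y powr - (real (CARD('d) - 2) * \<alpha>)) * indicator {y. 4 \<le> norm y} (y::real^'d) \<partial>lborel) < \<infinity>"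
    using assms by (subst nn_integral_norm_powr_outside_finite_iff) auto
  then have "ennreal k * (\<integral>\<^sup>+y. ennreal (norm y powr - (real (CARD('d) - 2) * \<alpha>)) * indicator {y. 4 \<le> norm y} (y::real^'d) \<partial>lborel) = \<infinity>"
    using \<open>k > 0\<close> by (simp add: ennreal_mult_eq_top_iff not_less top_unique)
  then show ?thesis using k by (simp add: top_unique)
qed

text \<open>With s = 2r the regions increase to the punctured space as r decreases to 0, and the
  limiting power is not integrable at the origin. Monotone convergence carries the lower bound past
  any T, for all centres at once.\<close>

lemma conv_rho_P_bump_integral_unbounded:
  assumes "0 < \<alpha>" "real CARD('d) \<le> real (CARD('d) - 2) * \<alpha>"
  shows "\<exists>r>0. r \<le> 1 \<and> (\<forall>x::real^'d.
    ennreal T < (\<integral>\<^sup>+y. ennreal (\<bar>conv_rho_P (bump x r) y\<bar> powr \<alpha>) \<partial>lborel))"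
proof -
  let ?p = "real (CARD('d) - 2) * \<alpha>"
  have card: "3 \<le> CARD('d)"
    using assms zero_less_card_finite[where 'a = 'd] by (cases "CARD('d) \<le> 2") auto
  obtain k where "k > 0" and k: "\<And>(x::real^'d) r. 0 < r \<Longrightarrow>
     ennreal k * (\<integral>\<^sup>+y. ennreal (norm y powr - ?p) * indicator {y. 2 * r \<le> norm y} (y::real^'d) \<partial>lborel)
       \<le> (\<integral>\<^sup>+y. ennreal (\<bar>conv_rho_P (bump x r) y\<bar> powr \<alpha>) \<partial>lborel)"
    using conv_rho_P_bump_integral_ge[OF assms(1), where 'd = 'd] card by force
  define r where "r n = 1 / real (Suc n)" for n
  have r: "0 < r n" "r n \<le> 1" for n by (auto simp: r_def)
  let ?g = "\<lambda>n y. ennreal (norm y powr - ?p) * indicator {y. 2 * r n \<le> norm y} (y::real^'d)"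
  have "decseq r" unfolding decseq_def r_def by (auto simp: field_simps)
  then have inc: "incseq ?g"
    unfolding incseq_def le_fun_def
    by (auto simp: indicator_def decseq_def) (meson mult_left_mono order_trans zero_le_numeral)
  have "(\<integral>\<^sup>+y. (SUP n. ?g n y) \<partial>lborel) = (SUP n. \<integral>\<^sup>+y. ?g n y \<partial>lborel)"
    by (rule nn_integral_monotone_convergence_SUP[OF inc]) measurable
  moreover have "(\<integral>\<^sup>+y. (SUP n. ?g n y) \<partial>lborel) = \<infinity>"
  proof -
    have "\<not> (\<integral>\<^sup>+y. ennreal (norm y powr - ?p) * indicator {y. norm y < 1} (y::real^'d) \<partial>lborel) < \<infinity>"
      using assms by (subst nn_integral_norm_powr_inside_finite_iff) (auto simp del: of_nat_diff)
    moreover have "(\<integral>\<^sup>+y. ennreal (norm y powr - ?p) * indicator {y. norm y < 1} (y::real^'d) \<partial>lborel)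
        \<le> (\<integral>\<^sup>+y. (SUP n. ?g n y) \<partial>lborel)"
    proof (rule nn_integral_mono)
      fix y :: "real^'d"
      show "ennreal (norm y powr - ?p) * indicator {y. norm y < 1} y \<le> (SUP n. ?g n y)"
      proof (cases "y = 0")
        case False
        then obtain n where "inverse (real (Suc n)) < norm y / 2"
          using reals_Archimedean[of "norm y / 2"] by auto
        then have "2 * r n \<le> norm y" by (simp add: r_def inverse_eq_divide)
        then have "ennreal (norm y powr - ?p) * indicator {y. norm y < 1} y \<le> ?g n y"
          by (auto simp: indicator_def)
        then show ?thesis by (rule order_trans) (rule SUP_upper, simp)
      qed simp
    qed
    ultimately show ?thesis by (simp add: not_less top_unique)
  qed
  ultimately have "(SUP n. \<integral>\<^sup>+y. ?g n y \<partial>lborel) = \<infinity>" by simp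
  then have "ennreal (T / k) < (SUP n. \<integral>\<^sup>+y. ?g n y \<partial>lborel)"
    by (simp only: infinity_ennreal_def ennreal_less_top)
  then obtain n where n: "ennreal (T / k) < (\<integral>\<^sup>+y. ?g n y \<partial>lborel)"
    unfolding less_SUP_iff by auto
  have "ennreal T = ennreal k * ennreal (T / k)"
    using \<open>k > 0\<close> by (subst ennreal_mult'[symmetric]) auto
  also have "\<dots> < ennreal k * (\<integral>\<^sup>+y. ?g n y \<partial>lborel)"
    using n \<open>k > 0\<close> by (intro ennreal_mult_strict_left_mono) auto
  finally have "ennreal T < (\<integral>\<^sup>+y. ennreal (\<bar>conv_rho_P (bump x (r n)) y\<bar> powr \<alpha>) \<partial>lborel)" for x :: "real^'d"
    using k[OF r(1)] by (rule less_le_trans)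
  then show ?thesis using r by blast
qed

lemma test_function_bounded_support:
  fixes \<phi> :: "real^'d \<Rightarrow> real"
  assumes "\<phi> \<in> test_functions"
  shows "\<exists>C>0. \<exists>R>0. \<forall>y. \<bar>\<phi> y\<bar> \<le> C * indicator (cball 0 R) y"
    and "\<phi> \<in> borel_measurable borel"
proof -
  have "Ck 0 \<phi>" and comp: "compact (closure {x. \<phi> x \<noteq> 0})"
    using assms unfolding test_functions_def by blast+
  then have cont: "continuous_on UNIV \<phi>" by simp
  then show "\<phi> \<in> borel_measurable borel" by (rule borel_measurable_continuous_onI)
  have "bounded (\<phi> ` closure {x. \<phi> x \<noteq> 0})"
    using comp continuous_on_subset[OF cont]
    by (intro compact_imp_bounded compact_continuous_image) auto
  then obtain C where "C > 0" and C: "\<And>y. y \<in> closure {x. \<phi> x \<noteq> 0} \<Longrightarrow> \<bar>\<phi> y\<bar> \<le> C"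
    unfolding bounded_pos by auto
  obtain R where "R > 0" and R: "\<And>y. y \<in> closure {x. \<phi> x \<noteq> 0} \<Longrightarrow> norm y \<le> R"
    using compact_imp_bounded[OF comp] unfolding bounded_pos by auto
  have "\<bar>\<phi> y\<bar> \<le> C * indicator (cball 0 R) y" for y
    using C[of y] R[of y] \<open>C > 0\<close> closure_subset[of "{x. \<phi> x \<noteq> 0}"]
    by (cases "\<phi> y = 0") (auto simp: indicator_def)
  then show "\<exists>C>0. \<exists>R>0. \<forall>y. \<bar>\<phi> y\<bar> \<le> C * indicator (cball 0 R) y"
    using \<open>C > 0\<close> \<open>R > 0\<close> by blast
qed

text \<open>A function that is not integrable has Bochner integral 0, so the bound holds in that
  case too.\<close>

lemma ennreal_abs_integral_le: "ennreal \<bar>\<integral>x. f x \<partial>N\<bar> \<le> (\<integral>\<^sup>+x. ennreal \<bar>f x\<bar> \<partial>N)" for f :: "'a \<Rightarrow> real"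
proof (cases "integrable N f")
  case True
  then show ?thesis using integral_norm_bound_ennreal[OF True] by simp
qed (simp add: not_integrable_integral_eq)

text \<open>Near the support the potential is bounded, because the exponent d - 2 is below d and so
  the kernel is locally integrable; far away every point of the support is at distance at least half
  of \<open>norm y\<close>.\<close>

lemma conv_rho_P_upper_bound:
  fixes \<phi> :: "real^'d \<Rightarrow> real"
  assumes card: "3 \<le> CARD('d)" and \<phi>: "\<phi> \<in> test_functions"
  shows "\<exists>B R. 0 < R \<and> 0 \<le> B \<and> (\<forall>y. norm y < R \<longrightarrow> \<bar>conv_rho_P \<phi> y\<bar> \<le> B)
    \<and> (\<forall>y. R \<le> norm y \<longrightarrow> \<bar>conv_rho_P \<phi> y\<bar> \<le> B * norm y powr - real (CARD('d) - 2))"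
proof -
  let ?m = "real (CARD('d) - 2)"
  obtain C R where "C > 0" "R > 0" and CR: "\<And>y. \<bar>\<phi> y\<bar> \<le> C * indicator (cball 0 R) y"
    using test_function_bounded_support(1)[OF \<phi>] by blast
  have [measurable]: "cball 0 R \<in> sets (borel :: (real^'d) measure)" by simp
  obtain K where "K > 0" and K: "\<And>z::real^'d. rho_P z = K * norm z powr - ?m"
    using rho_P_eq_powr[OF card] by blast
  have bound: "ennreal \<bar>conv_rho_P \<phi> y\<bar> \<le> ennreal (K * C) *
      (\<integral>\<^sup>+z. ennreal (norm (z - y) powr - ?m) * indicator (cball 0 R) z \<partial>lborel)" for y
  proof -
    have "ennreal \<bar>conv_rho_P \<phi> y\<bar> \<le> (\<integral>\<^sup>+z. ennreal \<bar>rho_P (z - y) * \<phi> z\<bar> \<partial>lborel)"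
      unfolding conv_rho_P_def by (rule ennreal_abs_integral_le)
    also have "\<dots> \<le> (\<integral>\<^sup>+z. ennreal (K * C) * (ennreal (norm (z - y) powr - ?m) * indicator (cball 0 R) z) \<partial>lborel)"
    proof (rule nn_integral_mono)
      fix z
      have "\<bar>rho_P (z - y) * \<phi> z\<bar> \<le> (K * norm (z - y) powr - ?m) * (C * indicator (cball 0 R) z)"
        unfolding abs_mult K using CR[of z] \<open>K > 0\<close> by (intro mult_mono) auto
      also have "\<dots> = (K * C) * (norm (z - y) powr - ?m * indicator (cball 0 R) z)" by simp
      finally show "ennreal \<bar>rho_P (z - y) * \<phi> z\<bar>
          \<le> ennreal (K * C) * (ennreal (norm (z - y) powr - ?m) * indicator (cball 0 R) z)"
        using \<open>K > 0\<close> \<open>C > 0\<close>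
        by (auto simp: ennreal_mult'[symmetric] indicator_def intro!: ennreal_leI split: if_splits)
    qed
    also have "\<dots> = ennreal (K * C) * (\<integral>\<^sup>+z. ennreal (norm (z - y) powr - ?m) * indicator (cball 0 R) z \<partial>lborel)"
      by (rule nn_integral_cmult) measurable
    finally show ?thesis .
  qed
  \<comment> \<open>With \<open>norm y < 2 * R\<close> and \<open>norm z \<le> R\<close> the
    difference is shorter than 3R, so the radius 4R leaves room.\<close>
  have near_fin: "(\<integral>\<^sup>+w. ennreal (norm w powr - ?m) * indicator {w. norm w < 4 * R} (w::real^'d) \<partial>lborel) < \<infinity>"
    using \<open>R > 0\<close> card by (subst nn_integral_norm_powr_inside_finite_iff) auto
  then obtain I where I: "0 \<le> I"
    "(\<integral>\<^sup>+w. ennreal (norm w powr - ?m) * indicator {w. norm w < 4 * R} (w::real^'d) \<partial>lborel) = ennreal I"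
    by (cases "\<integral>\<^sup>+w. ennreal (norm w powr - ?m) * indicator {w. norm w < 4 * R} (w::real^'d) \<partial>lborel"
        rule: ennreal_cases) auto
  have near: "\<bar>conv_rho_P \<phi> y\<bar> \<le> K * C * I" if "norm y < 2 * R" for y
  proof -
    have "(\<integral>\<^sup>+z. ennreal (norm (z - y) powr - ?m) * indicator (cball 0 R) z \<partial>lborel)
        \<le> (\<integral>\<^sup>+z. ennreal (norm (z - y) powr - ?m) * indicator {w. norm w < 4 * R} (z - y) \<partial>lborel)"
    proof (rule nn_integral_mono)
      fix z
      show "ennreal (norm (z - y) powr - ?m) * indicator (cball 0 R) z
          \<le> ennreal (norm (z - y) powr - ?m) * indicator {w. norm w < 4 * R} (z - y)"
        using norm_triangle_ineq4[of z y] that \<open>R > 0\<close> by (auto simp: indicator_def)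
    qed
    also have "\<dots> = ennreal I"
      unfolding I(2)[symmetric] by (rule nn_integral_translate) measurable
    finally have "ennreal \<bar>conv_rho_P \<phi> y\<bar> \<le> ennreal (K * C) * ennreal I"
      using bound[of y] by (meson mult_left_mono order_trans zero_le)
    then show ?thesis
      using \<open>K > 0\<close> \<open>C > 0\<close> I(1) by (simp add: ennreal_mult'[symmetric])
  qed
  define V where "V = measure lborel (cball (0::real^'d) R)"
  have V: "emeasure lborel (cball (0::real^'d) R) = ennreal V" "0 \<le> V"
    unfolding V_def using emeasure_lborel_cball_finite[of "0::real^'d" R]
    by (auto simp: emeasure_eq_ennreal_measure less_top)
  have far: "\<bar>conv_rho_P \<phi> y\<bar> \<le> K * C * (1 / 2) powr - ?m * V * norm y powr - ?m" if "2 * R \<le> norm y" for y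
  proof -
    have "(\<integral>\<^sup>+z. ennreal (norm (z - y) powr - ?m) * indicator (cball 0 R) z \<partial>lborel)
        \<le> (\<integral>\<^sup>+z. ennreal ((1 / 2 * norm y) powr - ?m) * indicator (cball 0 R) (z::real^'d) \<partial>lborel)"
    proof (rule nn_integral_mono)
      fix z
      have "norm z \<le> R \<Longrightarrow> 1 / 2 * norm y \<le> norm (z - y)"
        using norm_triangle_ineq2[of y z] that by (simp add: norm_minus_commute)
      moreover have "0 < 1 / 2 * norm y" using that \<open>R > 0\<close> by linarith
      ultimately show "ennreal (norm (z - y) powr - ?m) * indicator (cball 0 R) z
          \<le> ennreal ((1 / 2 * norm y) powr - ?m) * indicator (cball 0 R) z"
        by (cases "norm z \<le> R") (auto intro!: ennreal_leI powr_mono2' simp del: of_nat_diff)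
    qed
    also have "\<dots> = ennreal ((1 / 2 * norm y) powr - ?m * V)"
      using V by (simp add: nn_integral_cmult ennreal_mult')
    finally have "ennreal \<bar>conv_rho_P \<phi> y\<bar> \<le> ennreal (K * C) * ennreal ((1 / 2 * norm y) powr - ?m * V)"
      using bound[of y] by (meson mult_left_mono order_trans zero_le)
    then have "\<bar>conv_rho_P \<phi> y\<bar> \<le> K * C * ((1 / 2 * norm y) powr - ?m * V)"
      using \<open>K > 0\<close> \<open>C > 0\<close> V(2) by (simp add: ennreal_mult'[symmetric])
    moreover have "(1 / 2 * norm y) powr - ?m = (1 / 2) powr - ?m * norm y powr - ?m"
      by (rule powr_mult)
    ultimately show ?thesis by (simp only: mult_ac)
  qed
  let ?B = "max (K * C * I) (K * C * (1 / 2) powr - ?m * V)"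
  have "0 \<le> ?B" using \<open>K > 0\<close> \<open>C > 0\<close> I(1) by (simp add: le_max_iff_disj)
  moreover have "\<bar>conv_rho_P \<phi> y\<bar> \<le> ?B * norm y powr - ?m" if "2 * R \<le> norm y" for y
    using far[OF that] by (rule order_trans) (intro mult_right_mono, auto)
  moreover have "\<bar>conv_rho_P \<phi> y\<bar> \<le> ?B" if "norm y < 2 * R" for y
    using near[OF that] by simp
  ultimately show ?thesis using \<open>R > 0\<close> by (intro exI[of _ ?B] exI[of _ "2 * R"]) auto
qed

text \<open>The potential is bounded on a ball, and outside its \<alpha>-th power decays with an
  exponent above d.\<close>

lemma conv_rho_P_Lp:
  fixes \<phi> :: "real^'d \<Rightarrow> real"
  assumes "0 < \<alpha>" "real CARD('d) < real (CARD('d) - 2) * \<alpha>" and \<phi>: "\<phi> \<in> test_functions"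
  shows "(\<integral>\<^sup>+y. ennreal (\<bar>conv_rho_P \<phi> y\<bar> powr \<alpha>) \<partial>lborel) < \<infinity>"
proof -
  let ?m = "real (CARD('d) - 2)"
  have card: "3 \<le> CARD('d)"
    using assms zero_less_card_finite[where 'a = 'd] by (cases "CARD('d) \<le> 2") auto
  obtain B R where "0 < R" "0 \<le> B" and near: "\<And>y. norm y < R \<Longrightarrow> \<bar>conv_rho_P \<phi> y\<bar> \<le> B"
    and far: "\<And>y. R \<le> norm y \<Longrightarrow> \<bar>conv_rho_P \<phi> y\<bar> \<le> B * norm y powr - ?m"
    using conv_rho_P_upper_bound[OF card \<phi>] by blast
  have [measurable]: "ball 0 R \<in> sets (borel :: (real^'d) measure)" by simp
  have "(\<integral>\<^sup>+y. ennreal (\<bar>conv_rho_P \<phi> y\<bar> powr \<alpha>) \<partial>lborel)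
      \<le> (\<integral>\<^sup>+y. ennreal (B powr \<alpha>) * indicator (ball 0 R) (y::real^'d) +
          ennreal (B powr \<alpha>) * (ennreal (norm y powr - (?m * \<alpha>)) * indicator {y. R \<le> norm y} y) \<partial>lborel)"
  proof (rule nn_integral_mono)
    fix y :: "real^'d"
    show "ennreal (\<bar>conv_rho_P \<phi> y\<bar> powr \<alpha>) \<le> ennreal (B powr \<alpha>) * indicator (ball 0 R) y +
          ennreal (B powr \<alpha>) * (ennreal (norm y powr - (?m * \<alpha>)) * indicator {y. R \<le> norm y} y)"
    proof (cases "norm y < R")
      case True
      then show ?thesis
        using near[OF True] \<open>0 < \<alpha>\<close> by (auto intro!: ennreal_leI powr_mono2)
    next
      case False
      then have "\<bar>conv_rho_P \<phi> y\<bar> powr \<alpha> \<le> (B * norm y powr - ?m) powr \<alpha>"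
        using far[of y] \<open>0 < \<alpha>\<close> by (intro powr_mono2) auto
      then show ?thesis
        using False \<open>0 \<le> B\<close> by (simp add: powr_mult powr_powr ennreal_mult'[symmetric] ennreal_leI)
    qed
  qed
  also have "\<dots> = (\<integral>\<^sup>+y. ennreal (B powr \<alpha>) * indicator (ball 0 R) (y::real^'d) \<partial>lborel) +
      (\<integral>\<^sup>+y. ennreal (B powr \<alpha>) * (ennreal (norm y powr - (?m * \<alpha>)) * indicator {y. R \<le> norm y} (y::real^'d)) \<partial>lborel)"
    by (rule nn_integral_add) measurable
  also have "(\<integral>\<^sup>+y. ennreal (B powr \<alpha>) * indicator (ball 0 R) (y::real^'d) \<partial>lborel)
      = ennreal (B powr \<alpha>) * emeasure lborel (ball (0::real^'d) R)"
    by (rule nn_integral_cmult_indicator) simp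
  also have "(\<integral>\<^sup>+y. ennreal (B powr \<alpha>) * (ennreal (norm y powr - (?m * \<alpha>)) * indicator {y. R \<le> norm y} (y::real^'d)) \<partial>lborel)
      = ennreal (B powr \<alpha>) * (\<integral>\<^sup>+y. ennreal (norm y powr - (?m * \<alpha>)) * indicator {y. R \<le> norm y} (y::real^'d) \<partial>lborel)"
    by (rule nn_integral_cmult) measurable
  also have "ennreal (B powr \<alpha>) * emeasure lborel (ball (0::real^'d) R) +
      ennreal (B powr \<alpha>) * (\<integral>\<^sup>+y. ennreal (norm y powr - (?m * \<alpha>)) * indicator {y. R \<le> norm y} (y::real^'d) \<partial>lborel) < \<infinity>"
  proof -
    have "(\<integral>\<^sup>+y. ennreal (norm y powr - (?m * \<alpha>)) * indicator {y. R \<le> norm y} (y::real^'d) \<partial>lborel) < \<infinity>"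
      using assms \<open>0 < R\<close> by (subst nn_integral_norm_powr_outside_finite_iff) (auto simp del: of_nat_diff)
    then show ?thesis
      using emeasure_lborel_ball_finite[of "0::real^'d" R] by (simp add: ennreal_mult_less_top)
  qed
  finally show ?thesis .
qed

section \<open>Existence and nonexistence of the three kinds of solution\<close>

section \<open>Solutions\<close>

lemma one_minus_cos_le: "1 - cos s \<le> \<bar>s\<bar>" for s :: real
proof -
  have "\<bar>Re (iexp s - iexp 0)\<bar> \<le> \<bar>s - 0\<bar>"
    using abs_Re_le_cmod norm_iexp_diff_le by (rule order_trans)
  then show ?thesis by (simp add: Re_exp abs_le_iff)
qed

text \<open>The nonnegative form 1 - cos lets the characteristic function enter iterated integrals
  by Tonelli's theorem.\<close>

lemma (in prob_space) nn_integral_one_minus_cos: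
  assumes [measurable]: "X \<in> borel_measurable M"
  shows "(\<integral>\<^sup>+\<omega>. ennreal (1 - cos (t * X \<omega>)) \<partial>M) = ennreal (1 - Re (char (distr M borel X) t))"
proof -
  have "integrable M (\<lambda>\<omega>. iexp (t * X \<omega>))"
    by (rule integrable_const_bound[of _ 1]; simp)
  then have "(\<integral>\<omega>. Re (iexp (t * X \<omega>)) \<partial>M) = Re (char (distr M borel X) t)"
    by (simp only: integral_Re char_distr[OF assms])
  then have E: "(\<integral>\<omega>. cos (t * X \<omega>) \<partial>M) = Re (char (distr M borel X) t)"
    by (simp add: Re_exp)
  have int: "integrable M (\<lambda>\<omega>. cos (t * X \<omega>))"
    by (rule integrable_const_bound[of _ 1]; simp)
  then have "(\<integral>\<^sup>+\<omega>. ennreal (1 - cos (t * X \<omega>)) \<partial>M) = ennreal (\<integral>\<omega>. 1 - cos (t * X \<omega>) \<partial>M)"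
    by (intro nn_integral_eq_integral) auto
  also have "(\<integral>\<omega>. 1 - cos (t * X \<omega>) \<partial>M) = 1 - Re (char (distr M borel X) t)"
    using int E by (simp add: prob_space)
  finally show ?thesis .
qed

text \<open>For \<open>norm x \<le> 1\<close> and r \<le> 1 the bump lives in the ball of radius 2.
  After exchanging the integrals, symmetry makes the bump integrate to 1 over x.\<close>

lemma nn_integral_bump_average_le:
  fixes y :: "real^'d \<Rightarrow> real"
  assumes [measurable]: "y \<in> borel_measurable borel" and r: "0 < r" "r \<le> 1"
  shows "(\<integral>\<^sup>+x. ennreal \<bar>\<integral>z. y z * bump x r z \<partial>lborel\<bar> * indicator (cball 0 1) x \<partial>lborel)
    \<le> (\<integral>\<^sup>+z. ennreal \<bar>y z\<bar> * indicator (cball 0 2) z \<partial>lborel)"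
proof -
  have [measurable]: "cball 0 2 \<in> sets (borel :: (real^'d) measure)" by simp
  have "(\<integral>\<^sup>+x. ennreal \<bar>\<integral>z. y z * bump x r z \<partial>lborel\<bar> * indicator (cball 0 1) x \<partial>lborel)
      \<le> (\<integral>\<^sup>+x. \<integral>\<^sup>+z. ennreal \<bar>y z\<bar> * indicator (cball 0 2) z * ennreal (bump z r x) \<partial>lborel \<partial>lborel)"
  proof (rule nn_integral_mono)
    fix x :: "real^'d"
    show "ennreal \<bar>\<integral>z. y z * bump x r z \<partial>lborel\<bar> * indicator (cball 0 1) x
        \<le> (\<integral>\<^sup>+z. ennreal \<bar>y z\<bar> * indicator (cball 0 2) z * ennreal (bump z r x) \<partial>lborel)"
    proof (cases "x \<in> cball 0 1")
      case True
      have "ennreal \<bar>\<integral>z. y z * bump x r z \<partial>lborel\<bar> \<le> (\<integral>\<^sup>+z. ennreal \<bar>y z * bump x r z\<bar> \<partial>lborel)"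
        by (rule ennreal_abs_integral_le)
      also have "\<dots> \<le> (\<integral>\<^sup>+z. ennreal \<bar>y z\<bar> * indicator (cball 0 2) z * ennreal (bump z r x) \<partial>lborel)"
      proof (rule nn_integral_mono)
        fix z :: "real^'d"
        show "ennreal \<bar>y z * bump x r z\<bar> \<le> ennreal \<bar>y z\<bar> * indicator (cball 0 2) z * ennreal (bump z r x)"
        proof (cases "z \<in> cball 0 2")
          case True
          then show ?thesis
            using bump_nonneg[OF r(1), of z x] by (simp add: abs_mult ennreal_mult' bump_commute[of x r z])
        next
          case False
          then have "1 \<le> norm (z - x)"
            using True norm_triangle_ineq2[of z x] by simp
          then show ?thesis using bump_eq_0[OF r(1), of z x] r by simp
        qed
      qed
      finally show ?thesis using True by simp
    qed simp
  qed
  also have "\<dots> = (\<integral>\<^sup>+z. \<integral>\<^sup>+x. ennreal \<bar>y z\<bar> * indicator (cball 0 2) z * ennreal (bump z r x) \<partial>lborel \<partial>lborel)"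
    by (rule lborel_pair.Fubini') measurable
  also have "\<dots> = (\<integral>\<^sup>+z. ennreal \<bar>y z\<bar> * indicator (cball 0 2) z \<partial>lborel)"
    by (simp add: nn_integral_cmult bump_nn_integral[OF r(1)])
  finally show ?thesis .
qed

context stable_white_noise
begin

text \<open>The integral of \<open>1 - cos (t * Z r x \<omega>)\<close> over the unit ball and the
  probability space is estimated twice: from above by a bound that is uniform in r and vanishes as t
  tends to 0, from below by \<open>L / 2\<close> for some r depending on t.\<close>

lemma no_random_field_solution:
  assumes \<alpha>: "0 < \<alpha>" "real CARD('d) \<le> real (CARD('d) - 2) * \<alpha>"
  shows "\<not> random_field_solution M W Y"
proof
  assume "random_field_solution M W Y"
  then obtain u where Y: "(\<lambda>(x, \<omega>). Y x \<omega>) \<in> borel_measurable (borel \<Otimes>\<^sub>M M)"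
    and loc: "AE \<omega> in M. \<forall>K. compact K \<longrightarrow> set_integrable lborel K (\<lambda>x. Y x \<omega>)"
    and gen: "generalized_solution M W u"
    and rep: "\<And>\<phi>. \<phi> \<in> test_functions \<Longrightarrow> AE \<omega> in M. u \<phi> \<omega> = (\<integral>x. Y x \<omega> * \<phi> x \<partial>lborel)"
    unfolding random_field_solution_def by blast
  \<comment> \<open>Joint measurability in composed form, so that sections and iterated integrals of
    \<open>Y\<close> are recognised as measurable.\<close>
  have Ym[measurable (raw)]: "(\<lambda>w. Y (f w) (g w)) \<in> borel_measurable N"
    if "f \<in> measurable N borel" "g \<in> measurable N M" for f g and N :: "'z measure"
    using measurable_compose[OF measurable_Pair[OF that] Y] by simp
  interpret P: pair_sigma_finite "lborel :: (real^'d) measure" M ..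
  let ?B = "cball 0 1 :: (real^'d) set" and ?B2 = "cball 0 2 :: (real^'d) set"
  have [measurable]: "?B \<in> sets borel" "?B2 \<in> sets borel" by simp_all
  define L where "L = measure lborel ?B"
  have L: "emeasure lborel ?B = ennreal L"
    unfolding L_def using emeasure_lborel_cball_finite[of "0::real^'d" 1]
    by (auto simp: emeasure_eq_ennreal_measure less_top)
  have "0 < L" unfolding L_def by (rule content_cball_pos) simp
  define J where "J \<omega> = (\<integral>\<^sup>+z. ennreal \<bar>Y z \<omega>\<bar> * indicator ?B2 z \<partial>lborel)" for \<omega>
  have [measurable]: "J \<in> borel_measurable M"
    unfolding J_def by measurable
  have J_fin: "AE \<omega> in M. J \<omega> < \<infinity>"
    using loc
  proof eventually_elim
    case (elim \<omega>)
    then have "integrable lborel (\<lambda>z. indicator ?B2 z *\<^sub>R Y z \<omega>)"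
      by (simp add: set_integrable_def)
    then have "(\<integral>\<^sup>+z. ennreal (norm (indicator ?B2 z *\<^sub>R Y z \<omega>)) \<partial>lborel) < \<infinity>"
      by (simp only: integrable_iff_bounded)
    also have "(\<integral>\<^sup>+z. ennreal (norm (indicator ?B2 z *\<^sub>R Y z \<omega>)) \<partial>lborel) = J \<omega>"
      unfolding J_def by (intro nn_integral_cong) (auto simp: indicator_def)
    finally show ?case .
  qed
  define Z where "Z r x \<omega> = (\<integral>z. Y z \<omega> * bump x r z \<partial>lborel)" for r x \<omega>
  have Zm[measurable]: "(\<lambda>(x, \<omega>). Z r x \<omega>) \<in> borel_measurable (lborel \<Otimes>\<^sub>M M)" for r
    unfolding Z_def by measurable
  let ?D = "\<lambda>t r \<omega>. \<integral>\<^sup>+x. ennreal (1 - cos (t * Z r x \<omega>)) * indicator ?B x \<partial>lborel"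
  have upper: "?D t r \<omega> \<le> min (ennreal (2 * L)) (ennreal t * J \<omega>)"
    if "0 < t" "0 < r" "r \<le> 1" "\<omega> \<in> space M" for t r \<omega>
  proof (rule min.boundedI)
    have "?D t r \<omega> \<le> (\<integral>\<^sup>+x. ennreal 2 * indicator ?B x \<partial>lborel)"
    proof (intro nn_integral_mono mult_right_mono ennreal_leI)
      show "1 - cos (t * Z r x \<omega>) \<le> 2" for x using cos_ge_minus_one[of "t * Z r x \<omega>"] by linarith
    qed simp
    also have "\<dots> = ennreal (2 * L)"
      using L \<open>0 < L\<close> by (simp add: nn_integral_cmult ennreal_mult')
    finally show "?D t r \<omega> \<le> ennreal (2 * L)" .
    have [measurable]: "(\<lambda>z. Y z \<omega>) \<in> borel_measurable borel"
      using that by (intro Ym) auto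
    have "?D t r \<omega> \<le> (\<integral>\<^sup>+x. ennreal t * (ennreal \<bar>Z r x \<omega>\<bar> * indicator ?B x) \<partial>lborel)"
    proof (rule nn_integral_mono)
      fix x
      have "1 - cos (t * Z r x \<omega>) \<le> t * \<bar>Z r x \<omega>\<bar>"
        using one_minus_cos_le[of "t * Z r x \<omega>"] \<open>0 < t\<close> by (simp add: abs_mult)
      then show "ennreal (1 - cos (t * Z r x \<omega>)) * indicator ?B x
          \<le> ennreal t * (ennreal \<bar>Z r x \<omega>\<bar> * indicator ?B x)"
        using \<open>0 < t\<close> by (auto simp: indicator_def ennreal_mult'[symmetric] intro: ennreal_leI)
    qed
    also have "\<dots> = ennreal t * (\<integral>\<^sup>+x. ennreal \<bar>Z r x \<omega>\<bar> * indicator ?B x \<partial>lborel)"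
      unfolding Z_def by (rule nn_integral_cmult) measurable
    also have "\<dots> \<le> ennreal t * J \<omega>"
      unfolding Z_def J_def using that by (intro mult_left_mono nn_integral_bump_average_le) auto
    finally show "?D t r \<omega> \<le> ennreal t * J \<omega>" .
  qed
  have lower: "\<exists>r>0. r \<le> 1 \<and> ennreal (L / 2) \<le> (\<integral>\<^sup>+\<omega>. ?D t r \<omega> \<partial>M)" if "0 < t" for t
  proof -
    \<comment> \<open>A scale \<open>I\<close> above \<open>ln 2 / t powr \<alpha>\<close> makes
      \<open>exp (- I * t powr \<alpha>)\<close> at most 1/2.\<close>
    obtain r where r: "0 < r" "r \<le> 1" and big: "\<And>x::real^'d.
        ennreal (ln 2 / t powr \<alpha>) < (\<integral>\<^sup>+y. ennreal (\<bar>conv_rho_P (bump x r) y\<bar> powr \<alpha>) \<partial>lborel)"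
      using conv_rho_P_bump_integral_unbounded[OF \<alpha>] by blast
    have half: "ennreal (1 / 2) \<le> (\<integral>\<^sup>+\<omega>. ennreal (1 - cos (t * Z r x \<omega>)) \<partial>M)" for x
    proof -
      have test: "bump x r \<in> test_functions"
        by (rule bump_span_test_function[OF bump_in_bump_span]) (use r in simp)
      then have int: "has_stoch_integral M W (conv_rho_P (bump x r)) (u (bump x r))"
        using gen unfolding generalized_solution_def by blast
      then have [measurable]: "u (bump x r) \<in> borel_measurable M"
        by (simp add: has_stoch_integral_def)
      obtain I where "0 \<le> I"
        and I: "(\<integral>\<^sup>+y. ennreal (\<bar>conv_rho_P (bump x r) y\<bar> powr \<alpha>) \<partial>lborel) \<le> ennreal I"
        and ch: "char (distr M borel (u (bump x r))) t = complex_of_real (exp (- I * \<bar>t\<bar> powr \<alpha>))"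
        using has_stoch_integral_char[OF int \<alpha>(1)] by blast
      have "ennreal (ln 2 / t powr \<alpha>) < ennreal I" using big[of x] I by (rule less_le_trans)
      then have "ln 2 / t powr \<alpha> < I" using \<open>0 \<le> I\<close> by (simp add: ennreal_less_iff)
      then have "ln 2 \<le> I * t powr \<alpha>" using \<open>0 < t\<close> by (simp add: field_simps)
      then have "exp (- I * \<bar>t\<bar> powr \<alpha>) \<le> exp (- ln 2)" using \<open>0 < t\<close> by simp
      then have le: "exp (- I * \<bar>t\<bar> powr \<alpha>) \<le> 1 / 2" by (simp add: exp_minus)
      have "ennreal (1 / 2) \<le> ennreal (1 - Re (char (distr M borel (u (bump x r))) t))"
        unfolding ch Re_complex_of_real using le by (intro ennreal_leI) linarith
      also have "\<dots> = (\<integral>\<^sup>+\<omega>. ennreal (1 - cos (t * u (bump x r) \<omega>)) \<partial>M)"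
        by (rule nn_integral_one_minus_cos[symmetric]) measurable
      \<comment> \<open>The representation holds almost surely for each fixed x; this is enough
        because the mean is taken before integrating over x.\<close>
      also have "\<dots> = (\<integral>\<^sup>+\<omega>. ennreal (1 - cos (t * Z r x \<omega>)) \<partial>M)"
        using rep[OF test] by (intro nn_integral_cong_AE) (auto simp: Z_def elim: eventually_mono)
      finally show ?thesis .
    qed
    have "ennreal (L / 2) = ennreal (1 / 2) * ennreal L"
      using \<open>0 < L\<close> by (subst ennreal_mult'[symmetric]) auto
    also have "\<dots> = (\<integral>\<^sup>+x. ennreal (1 / 2) * indicator ?B x \<partial>lborel)"
      by (simp add: nn_integral_cmult L)
    also have "\<dots> \<le> (\<integral>\<^sup>+x. (\<integral>\<^sup>+\<omega>. ennreal (1 - cos (t * Z r x \<omega>)) \<partial>M) * indicator ?B x \<partial>lborel)"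
      by (intro nn_integral_mono mult_right_mono half) simp
    also have "\<dots> = (\<integral>\<^sup>+x. (\<integral>\<^sup>+\<omega>. ennreal (1 - cos (t * Z r x \<omega>)) * indicator ?B x \<partial>M) \<partial>lborel)"
      by (intro nn_integral_cong nn_integral_multc[symmetric]) measurable
    also have "\<dots> = (\<integral>\<^sup>+\<omega>. ?D t r \<omega> \<partial>M)"
      by (rule P.Fubini'[symmetric]) measurable
    finally show ?thesis using r by blast
  qed
  define t where "t n = inverse (real (Suc n))" for n
  have t_pos: "0 < t n" for n by (simp add: t_def)
  have t_lim: "t \<longlonglongrightarrow> 0"
    unfolding t_def[abs_def] by (rule LIMSEQ_inverse_real_of_nat)
  \<comment> \<open>\<open>J\<close> is finite almost surely but may have infinite mean, so the
    constant \<open>2 * L\<close> serves as the dominating function.\<close>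
  have "(\<lambda>n. \<integral>\<^sup>+\<omega>. min (ennreal (2 * L)) (ennreal (t n) * J \<omega>) \<partial>M) \<longlonglongrightarrow> (\<integral>\<^sup>+\<omega>. 0 \<partial>M)"
  proof (rule nn_integral_dominated_convergence)
    show "AE \<omega> in M. min (ennreal (2 * L)) (ennreal (t n) * J \<omega>) \<le> ennreal (2 * L)" for n by simp
    show "(\<integral>\<^sup>+\<omega>. ennreal (2 * L) \<partial>M) < \<infinity>" by (simp add: emeasure_space_1)
    show "AE \<omega> in M. (\<lambda>n. min (ennreal (2 * L)) (ennreal (t n) * J \<omega>)) \<longlonglongrightarrow> 0"
      using J_fin
    proof eventually_elim
      case (elim \<omega>)
      then obtain j where j: "0 \<le> j" "J \<omega> = ennreal j"
        by (cases "J \<omega>" rule: ennreal_cases) auto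
      have "(\<lambda>n. ennreal (min (2 * L) (t n * j))) \<longlonglongrightarrow> ennreal (min (2 * L) (0 * j))"
        by (intro tendsto_intros t_lim tendsto_ennrealI)
      moreover have "ennreal (min (2 * L) (t n * j)) = min (ennreal (2 * L)) (ennreal (t n) * J \<omega>)" for n
      proof -
        have "ennreal (t n) * J \<omega> = ennreal (t n * j)"
          using j t_pos[of n] by (simp add: ennreal_mult')
        then show ?thesis using \<open>0 < L\<close> j t_pos[of n] by (simp add: min_def)
      qed
      ultimately show ?case using \<open>0 < L\<close> by simp
    qed
  qed measurable
  then have "\<forall>\<^sub>F n in sequentially. (\<integral>\<^sup>+\<omega>. min (ennreal (2 * L)) (ennreal (t n) * J \<omega>) \<partial>M) < ennreal (L / 2)"
    using \<open>0 < L\<close> by (intro order_tendstoD(2)) auto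
  then obtain n where n: "(\<integral>\<^sup>+\<omega>. min (ennreal (2 * L)) (ennreal (t n) * J \<omega>) \<partial>M) < ennreal (L / 2)"
    unfolding eventually_sequentially by blast
  \<comment> \<open>The radius is chosen after n, which is allowed because the upper bound is the
    same for every r in (0, 1].\<close>
  obtain r where r: "0 < r" "r \<le> 1" "ennreal (L / 2) \<le> (\<integral>\<^sup>+\<omega>. ?D (t n) r \<omega> \<partial>M)"
    using lower[OF t_pos] by blast
  note r(3)
  also have "(\<integral>\<^sup>+\<omega>. ?D (t n) r \<omega> \<partial>M) \<le> (\<integral>\<^sup>+\<omega>. min (ennreal (2 * L)) (ennreal (t n) * J \<omega>) \<partial>M)"
    by (intro nn_integral_mono upper t_pos r)
  finally show False using n by simp
qed

lemma no_mild_solution: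
  assumes "0 < \<alpha>" shows "\<not> mild_solution M W u"
proof
  assume "mild_solution M W u"
  then have "has_stoch_integral M W (\<lambda>y. rho_P (0 - y)) (u 0)"
    unfolding mild_solution_def by blast
  from has_stoch_integral_char[OF this assms] obtain I
    where "(\<integral>\<^sup>+y. ennreal (\<bar>rho_P (0 - y :: real^'d)\<bar> powr \<alpha>) \<partial>lborel) \<le> ennreal I" by blast
  then show False unfolding rho_P_not_Lp[OF assms] by (simp add: top_unique)
qed

text \<open>The unit bump alone forces the condition. Conversely every potential lies in L^\<alpha>,
  and the functional is assembled by choosing one integral for each test function.\<close>

lemma generalized_solution_iff:
  assumes "0 < \<alpha>"
  shows "(\<exists>u. generalized_solution M W u) \<longleftrightarrow> real CARD('d) < real (CARD('d) - 2) * \<alpha>"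
proof
  assume "\<exists>u. generalized_solution M W u"
  then obtain u where u: "generalized_solution M W u" by blast
  have "bump (0::real^'d) 1 \<in> test_functions"
    by (rule bump_span_test_function[OF bump_in_bump_span]) simp
  then have "has_stoch_integral M W (conv_rho_P (bump 0 1)) (u (bump 0 1))"
    using u unfolding generalized_solution_def by blast
  from has_stoch_integral_char[OF this assms] obtain I
    where "(\<integral>\<^sup>+y. ennreal (\<bar>conv_rho_P (bump (0::real^'d) 1) y\<bar> powr \<alpha>) \<partial>lborel) \<le> ennreal I" by blast
  then have "(\<integral>\<^sup>+y. ennreal (\<bar>conv_rho_P (bump (0::real^'d) 1) y\<bar> powr \<alpha>) \<partial>lborel) \<noteq> \<infinity>"
    by (auto simp: top_unique)
  then show "real CARD('d) < real (CARD('d) - 2) * \<alpha>"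
    using conv_rho_P_bump_not_Lp[OF assms, where 'd = 'd] by (meson not_le)
next
  assume big: "real CARD('d) < real (CARD('d) - 2) * \<alpha>"
  have "\<forall>\<phi>\<in>test_functions. \<exists>X. has_stoch_integral M W (conv_rho_P \<phi>) X"
    using test_function_bounded_support(2) conv_rho_P_Lp[OF assms big]
    by (intro ballI has_stoch_integral_exists[OF _ assms] conv_rho_P_measurable) auto
  then show "\<exists>u. generalized_solution M W u"
    unfolding generalized_solution_def by (rule bchoice)
qed

end

theorem theorem6p12:
  fixes M :: "'w measure" and \<alpha> :: real and W :: "(real^'d) set \<Rightarrow> 'w \<Rightarrow> real"
  assumes "0 < \<alpha>" and "\<alpha> < 2"
    and "stable_white_noise M \<alpha> W"
  shows "(\<nexists>u. mild_solution M W u) \<and> (\<nexists>Y. random_field_solution M W Y) \<and>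
         ((\<exists>u. generalized_solution M W u) \<longleftrightarrow>
           CARD('d) > 4 \<and> \<alpha> \<in> {real CARD('d) / (real CARD('d) - 2) <..< 2})"
proof -
  interpret stable_white_noise M \<alpha> W by fact
  \<comment> \<open>A random field solution presupposes a generalized one; the condition for the
    latter puts the exponent in the range where the singularity at the origin is not
    \<alpha>-integrable.\<close>
  have "\<not> random_field_solution M W Y" for Y
  proof
    assume Y: "random_field_solution M W Y"
    then have "\<exists>u. generalized_solution M W u"
      unfolding random_field_solution_def by blast
    then have "real CARD('d) \<le> real (CARD('d) - 2) * \<alpha>"
      unfolding generalized_solution_iff[OF assms(1)] by (rule less_imp_le)
    then show False using no_random_field_solution[OF assms(1)] Y by blast
  qed
  moreover have "real CARD('d) < real (CARD('d) - 2) * \<alpha> \<longleftrightarrow>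
      CARD('d) > 4 \<and> \<alpha> \<in> {real CARD('d) / (real CARD('d) - 2) <..< 2}"
  \<comment> \<open>For d \<le> 2 truncated subtraction makes the product 0, so both sides fail. For
    larger d the condition together with \<alpha> < 2 implies d < 2(d - 2), that is d > 4.\<close>
  proof (cases "CARD('d) \<le> 2")
    case False
    then have d: "real (CARD('d) - 2) = real CARD('d) - 2" "0 < real CARD('d) - 2" by auto
    have "4 < CARD('d)" if "real CARD('d) < (real CARD('d) - 2) * \<alpha>"
    proof -
      have "(real CARD('d) - 2) * \<alpha> < (real CARD('d) - 2) * 2"
        using d assms(2) by (intro mult_strict_left_mono) auto
      then show ?thesis using that by simp
    qed
    then show ?thesis using d assms(2) by (auto simp: pos_divide_less_eq mult.commute)
  qed auto
  ultimately show ?thesis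
    using no_mild_solution[OF assms(1)] generalized_solution_iff[OF assms(1)] by blast
qed

end
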